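(* Let $\mathbf{SkePerLC}$ be the category of all locally compact Hausdorff spaces and all skeletal perfect maps between them. Let $\mathbf{ESkePerLC}$ be the category whose objects are all complete local contact algebras and whose morphisms $\psi:(A,\rho,\mathbb{B})\to(B,\eta,\mathbb{B}')$ are all functions $\psi:A\to B$ satisfying: (EF1) for every $a\in A$, $\psi(a)=0$ iff $a=0$; (EF2) $\psi$ preserves all joins; (EF3) if $a\in A$, $b\in B$ and $b\le\psi(a)$ then there exists $c\in A$ such that $c\le a$ and $\psi(c)=b$; (EL4) for all $a,b\in A$, $a\,\rho\,b$ implies $\psi(a)\,\eta\,\psi(b)$; (EL5) if $a\in\mathbb{B}$ then $\psi(a)\in\mathbb{B}'$; (EL6) if $b\in\mathbb{B}'$ then $\psi_P(b)\in\mathbb{B}$, where $\psi_P:B\to A$ is the right adjoint of $\psi$. Then the categories $\mathbf{SkePerLC}$ and $\mathbf{ESkePerLC}$ are equivalent.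
   Context: A function $f:X\to Y$ between topological spaces is skeletal if $\mathrm{int}(f^{-1}(\mathrm{cl}(V)))\subseteq \mathrm{cl}(f^{-1}(V))$ for every open $V\subseteq Y$. A map is perfect if it is continuous, closed, and all its point inverses are compact. Maps are not assumed to be onto. (For perfect maps between locally compact Hausdorff spaces, skeletal is the same as quasi-open, i.e. $\mathrm{int}(f(U))\neq\emptyset$ for each non-empty open $U$.) A contact algebra $(B,C)$ is a Boolean algebra $B=(B,0,1,\vee,\wedge,{}^* )$ ($0=1$ is allowed; $^*$ is complement) with a binary relation $C$ on $B$ such that: (C1) $a\neq 0$ implies $aCa$; (C2) $aCb$ implies $a\ne 0$ and $b\neq 0$; (C3) $aCb$ implies $bCa$; (C4) $aC(b\vee c)$ iff $aCb$ or $aCc$. Write $a\ll_C b$ iff not $aCb^*$. A local contact algebra $(B,\rho,\mathbb{B})$ consists of a contact algebra $(B,\rho)$ and an ideal $\mathbb{B}$ of $B$ (possibly non-proper) such that: (BC1) if $a\in\mathbb{B}$, $c\in B$ and $a\ll_\rho c$ then $a\ll_\rho b\ll_\rho c$ for some $b\in\mathbb{B}$; (BC2) if $a\rho b$ then there is $c\in\mathbb{B}$ with $a\rho(c\wedge b)$; (BC3) if $a\ne 0$ then there is $b\in\mathbb{B}\setminus\{0\}$ with $b\ll_\rho a$. It is complete if $B$ is a complete Boolean algebra. For a join-preserving $\psi:A\to B$ with $A$ complete, the right adjoint $\psi_P:B\to A$ is determined by: $\psi(a)\le b$ iff $a\le\psi_P(b)$. Composition of morphisms is composition of functions. *)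

theory Defs
  imports "HOL-Analysis.Analysis" "HOL-Algebra.Complete_Lattice"
begin

section \<open>Categories and equivalences\<close>

(* Hom-sets of different pairs of objects need not be disjoint; hence composition and the
   arrow part of a functor take the objects involved as arguments.
   Comp C X Y Z g f is "g after f" for f : X -> Y and g : Y -> Z. *)
record ('o, 'm) category =
  Obj :: "'o set"
  Hom :: "'o \<Rightarrow> 'o \<Rightarrow> 'm set"
  Ident :: "'o \<Rightarrow> 'm"
  Comp :: "'o \<Rightarrow> 'o \<Rightarrow> 'o \<Rightarrow> 'm \<Rightarrow> 'm \<Rightarrow> 'm"

locale category =
  fixes C :: "('o, 'm) category"
  assumes Ident_in_Hom: "X \<in> Obj C \<Longrightarrow> Ident C X \<in> Hom C X X"
    and Comp_in_Hom: "\<lbrakk>X \<in> Obj C; Y \<in> Obj C; Z \<in> Obj C; f \<in> Hom C X Y; g \<in> Hom C Y Z\<rbrakk>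
      \<Longrightarrow> Comp C X Y Z g f \<in> Hom C X Z"
    and Comp_Ident: "\<lbrakk>X \<in> Obj C; Y \<in> Obj C; f \<in> Hom C X Y\<rbrakk>
      \<Longrightarrow> Comp C X X Y f (Ident C X) = f"
    and Ident_Comp: "\<lbrakk>X \<in> Obj C; Y \<in> Obj C; f \<in> Hom C X Y\<rbrakk>
      \<Longrightarrow> Comp C X Y Y (Ident C Y) f = f"
    and Comp_assoc: "\<lbrakk>W \<in> Obj C; X \<in> Obj C; Y \<in> Obj C; Z \<in> Obj C;
        f \<in> Hom C W X; g \<in> Hom C X Y; h \<in> Hom C Y Z\<rbrakk>
      \<Longrightarrow> Comp C W Y Z h (Comp C W X Y g f) = Comp C W X Z (Comp C X Y Z h g) f"

definition iso_arrow :: "('o, 'm) category \<Rightarrow> 'o \<Rightarrow> 'o \<Rightarrow> 'm \<Rightarrow> bool" where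
  "iso_arrow C X Y f \<longleftrightarrow> f \<in> Hom C X Y \<and>
     (\<exists>g \<in> Hom C Y X. Comp C X Y X g f = Ident C X \<and> Comp C Y X Y f g = Ident C Y)"

record ('o, 'm, 'p, 'n) cat_functor =
  fobj :: "'o \<Rightarrow> 'p"
  fmap :: "'o \<Rightarrow> 'o \<Rightarrow> 'm \<Rightarrow> 'n"

definition is_functor ::
  "('o, 'm) category \<Rightarrow> ('p, 'n) category \<Rightarrow> ('o, 'm, 'p, 'n) cat_functor \<Rightarrow> bool" where
  "is_functor C D F \<longleftrightarrow>
     (\<forall>X \<in> Obj C. fobj F X \<in> Obj D) \<and>
     (\<forall>X \<in> Obj C. \<forall>Y \<in> Obj C. \<forall>f \<in> Hom C X Y.
        fmap F X Y f \<in> Hom D (fobj F X) (fobj F Y)) \<and>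
     (\<forall>X \<in> Obj C. fmap F X X (Ident C X) = Ident D (fobj F X)) \<and>
     (\<forall>X \<in> Obj C. \<forall>Y \<in> Obj C. \<forall>Z \<in> Obj C. \<forall>f \<in> Hom C X Y. \<forall>g \<in> Hom C Y Z.
        fmap F X Z (Comp C X Y Z g f) =
        Comp D (fobj F X) (fobj F Y) (fobj F Z) (fmap F Y Z g) (fmap F X Y f))"

definition id_functor :: "('o, 'm, 'o, 'm) cat_functor" where
  "id_functor = \<lparr>fobj = (\<lambda>X. X), fmap = (\<lambda>X Y f. f)\<rparr>"

definition comp_functor ::
  "('p, 'n, 'q, 'k) cat_functor \<Rightarrow> ('o, 'm, 'p, 'n) cat_functor \<Rightarrow> ('o, 'm, 'q, 'k) cat_functor" where
  "comp_functor G F = \<lparr>fobj = (\<lambda>X. fobj G (fobj F X)),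
     fmap = (\<lambda>X Y f. fmap G (fobj F X) (fobj F Y) (fmap F X Y f))\<rparr>"

definition natural_iso ::
  "('o, 'm) category \<Rightarrow> ('p, 'n) category \<Rightarrow>
   ('o, 'm, 'p, 'n) cat_functor \<Rightarrow> ('o, 'm, 'p, 'n) cat_functor \<Rightarrow> ('o \<Rightarrow> 'n) \<Rightarrow> bool" where
  "natural_iso C D F G \<tau> \<longleftrightarrow>
     (\<forall>X \<in> Obj C. iso_arrow D (fobj F X) (fobj G X) (\<tau> X)) \<and>
     (\<forall>X \<in> Obj C. \<forall>Y \<in> Obj C. \<forall>f \<in> Hom C X Y.
        Comp D (fobj F X) (fobj F Y) (fobj G Y) (\<tau> Y) (fmap F X Y f) =
        Comp D (fobj F X) (fobj G X) (fobj G Y) (fmap G X Y f) (\<tau> X))"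

definition equivalent_categories ::
  "('o, 'm) category \<Rightarrow> ('p, 'n) category \<Rightarrow> bool" where
  "equivalent_categories C D \<longleftrightarrow> category C \<and> category D \<and>
     (\<exists>F G \<eta> \<epsilon>. is_functor C D F \<and> is_functor D C G \<and>
        natural_iso C C id_functor (comp_functor G F) \<eta> \<and>
        natural_iso D D (comp_functor F G) id_functor \<epsilon>)"


section \<open>Universes\<close>

(* "All spaces" and "all algebras" means all those whose underlying set belongs to a fixed
   universe of small sets.  Only closure (up to bijection) under subsets and power sets is
   required, so every Grothendieck universe and the class of all small sets of a type of
   ZFC sets are instances. *)
definition universe :: "'u set set \<Rightarrow> bool" where
  "universe \<U> \<longleftrightarrow>
     (\<forall>A \<in> \<U>. \<forall>B. B \<subseteq> A \<longrightarrow> B \<in> \<U>) \<and>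
     (\<forall>A \<in> \<U>. \<exists>f. inj_on f (Pow A) \<and> f ` Pow A \<in> \<U>)"


section \<open>Locally compact Hausdorff spaces and skeletal perfect maps\<close>

definition skeletal_map :: "'a topology \<Rightarrow> 'b topology \<Rightarrow> ('a \<Rightarrow> 'b) \<Rightarrow> bool" where
  "skeletal_map X Y f \<longleftrightarrow> (\<forall>V. openin Y V \<longrightarrow>
     X interior_of {x \<in> topspace X. f x \<in> Y closure_of V}
       \<subseteq> X closure_of {x \<in> topspace X. f x \<in> V})"

(* The library's perfect_map also demands surjectivity, which is not wanted here;
   proper_map is "closed with compact point inverses".  Maps are extensional
   (undefined off the carrier), so that equality of morphisms is equality of functions
   on the space. *)
definition SkePerLC :: "'u set set \<Rightarrow> ('u topology, 'u \<Rightarrow> 'u) category" where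
  "SkePerLC \<U> = \<lparr>
     Obj = {X. topspace X \<in> \<U> \<and> locally_compact_space X \<and> Hausdorff_space X},
     Hom = (\<lambda>X Y. {f \<in> topspace X \<rightarrow>\<^sub>E topspace Y.
        continuous_map X Y f \<and> proper_map X Y f \<and> skeletal_map X Y f}),
     Ident = (\<lambda>X. \<lambda>x\<in>topspace X. x),
     Comp = (\<lambda>X Y Z g f. compose (topspace X) g f)\<rparr>"


section \<open>Local contact algebras\<close>

locale boolean_lattice = bounded_lattice L for L (structure) +
  assumes meet_join_distrib: "\<lbrakk>a \<in> carrier L; b \<in> carrier L; c \<in> carrier L\<rbrakk>
      \<Longrightarrow> a \<sqinter> (b \<squnion> c) = (a \<sqinter> b) \<squnion> (a \<sqinter> c)"
    and complemented: "a \<in> carrier L \<Longrightarrow> \<exists>b \<in> carrier L. a \<sqinter> b = \<bottom> \<and> a \<squnion> b = \<top>"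

definition complement :: "('a, 'r) gorder_scheme \<Rightarrow> 'a \<Rightarrow> 'a" where
  "complement L a =
     (THE b. b \<in> carrier L \<and> a \<sqinter>\<^bsub>L\<^esub> b = \<bottom>\<^bsub>L\<^esub> \<and> a \<squnion>\<^bsub>L\<^esub> b = \<top>\<^bsub>L\<^esub>)"

record 'a contact_structure = "'a gorder" +
  contact :: "'a rel"

record 'a local_contact_structure = "'a contact_structure" +
  bdd :: "'a set"

locale contact_algebra = boolean_lattice L for L (structure) +
  assumes contact_on_carrier: "contact L \<subseteq> carrier L \<times> carrier L"
    and C1: "\<lbrakk>a \<in> carrier L; a \<noteq> \<bottom>\<rbrakk> \<Longrightarrow> (a, a) \<in> contact L"
    and C2: "(a, b) \<in> contact L \<Longrightarrow> a \<noteq> \<bottom> \<and> b \<noteq> \<bottom>"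
    and C3: "(a, b) \<in> contact L \<Longrightarrow> (b, a) \<in> contact L"
    and C4: "\<lbrakk>a \<in> carrier L; b \<in> carrier L; c \<in> carrier L\<rbrakk>
      \<Longrightarrow> (a, b \<squnion> c) \<in> contact L \<longleftrightarrow> (a, b) \<in> contact L \<or> (a, c) \<in> contact L"

definition non_tangential :: "('a, 'r) contact_structure_scheme \<Rightarrow> 'a \<Rightarrow> 'a \<Rightarrow> bool"
    (infix \<open>\<lless>\<index>\<close> 50) where
  "a \<lless>\<^bsub>L\<^esub> b \<longleftrightarrow> (a, complement L b) \<notin> contact L"

definition lattice_ideal :: "('a, 'r) gorder_scheme \<Rightarrow> 'a set \<Rightarrow> bool" where
  "lattice_ideal L I \<longleftrightarrow> I \<subseteq> carrier L \<and> \<bottom>\<^bsub>L\<^esub> \<in> I \<and>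
     (\<forall>a \<in> I. \<forall>b \<in> carrier L. b \<sqsubseteq>\<^bsub>L\<^esub> a \<longrightarrow> b \<in> I) \<and>
     (\<forall>a \<in> I. \<forall>b \<in> I. a \<squnion>\<^bsub>L\<^esub> b \<in> I)"

locale local_contact_algebra = contact_algebra L
  for L :: "('a, 'r) local_contact_structure_scheme" (structure) +
  assumes ideal: "lattice_ideal L (bdd L)"
    and BC1: "\<lbrakk>a \<in> bdd L; c \<in> carrier L; a \<lless> c\<rbrakk> \<Longrightarrow> \<exists>b \<in> bdd L. a \<lless> b \<and> b \<lless> c"
    and BC2: "(a, b) \<in> contact L \<Longrightarrow> \<exists>c \<in> bdd L. (a, c \<sqinter> b) \<in> contact L"
    and BC3: "\<lbrakk>a \<in> carrier L; a \<noteq> \<bottom>\<rbrakk> \<Longrightarrow> \<exists>b \<in> bdd L. b \<noteq> \<bottom> \<and> b \<lless> a"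

locale complete_local_contact_algebra = local_contact_algebra L + complete_lattice L
  for L :: "('a, 'r) local_contact_structure_scheme" (structure)

definition right_adjoint ::
  "('a, 'r) gorder_scheme \<Rightarrow> ('b, 's) gorder_scheme \<Rightarrow> ('a \<Rightarrow> 'b) \<Rightarrow> 'b \<Rightarrow> 'a" where
  "right_adjoint A B \<psi> b =
     (THE p. p \<in> carrier A \<and> (\<forall>a \<in> carrier A. \<psi> a \<sqsubseteq>\<^bsub>B\<^esub> b \<longleftrightarrow> a \<sqsubseteq>\<^bsub>A\<^esub> p))"

definition ESkePerLC_hom ::
  "'a local_contact_structure \<Rightarrow> 'b local_contact_structure \<Rightarrow> ('a \<Rightarrow> 'b) set" where
  "ESkePerLC_hom A B = {\<psi> \<in> carrier A \<rightarrow>\<^sub>E carrier B.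
     (\<forall>a \<in> carrier A. \<psi> a = \<bottom>\<^bsub>B\<^esub> \<longleftrightarrow> a = \<bottom>\<^bsub>A\<^esub>) \<and>
     sup_pres A B \<psi> \<and>
     (\<forall>a \<in> carrier A. \<forall>b \<in> carrier B. b \<sqsubseteq>\<^bsub>B\<^esub> \<psi> a \<longrightarrow>
       (\<exists>c \<in> carrier A. c \<sqsubseteq>\<^bsub>A\<^esub> a \<and> \<psi> c = b)) \<and>
     (\<forall>a \<in> carrier A. \<forall>b \<in> carrier A.
       (a, b) \<in> contact A \<longrightarrow> (\<psi> a, \<psi> b) \<in> contact B) \<and>
     (\<forall>a \<in> bdd A. \<psi> a \<in> bdd B) \<and>
     (\<forall>b \<in> bdd B. right_adjoint A B \<psi> b \<in> bdd A)}"

definition ESkePerLC :: "'u set set \<Rightarrow> ('u local_contact_structure, 'u \<Rightarrow> 'u) category" where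
  "ESkePerLC \<U> = \<lparr>
     Obj = {A. carrier A \<in> \<U> \<and> complete_local_contact_algebra A},
     Hom = ESkePerLC_hom,
     Ident = (\<lambda>A. \<lambda>a\<in>carrier A. a),
     Comp = (\<lambda>A B D \<phi> \<psi>. compose (carrier A) \<phi> \<psi>)\<rparr>"

end

theory Submission
  imports Defs
begin

text \<open>
The equivalence is carried by the functor that sends a locally compact Hausdorff space \<open>X\<close> to the
complete Boolean algebra of its regular closed sets, where two sets are in contact when they
intersect and a set is bounded when it is compact, and sends a skeletal perfect map \<open>f\<close> to the direct
image \<open>F \<mapsto> f ` F\<close>.  The direct image is covariant and needs no closure: a continuous closed map
between such spaces is skeletal exactly when it carries regular closed sets to regular closed sets
(\<open>skeletal_image_regular_closed\<close>, \<open>skeletal_mapI_image_regular_closed\<close>).  Being full, faithful and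
essentially surjective, this functor is an equivalence (\<open>equivalent_categoriesI\<close>), so that a
quasi-inverse and its naturality never have to be written down.

Faithfulness holds because, in a locally compact Hausdorff space, a point is the intersection of its
regular closed neighbourhoods.

For fullness (\<open>induced_bij\<close>), let \<open>\<psi>\<close> be a morphism of algebras.  The value of the
corresponding map at \<open>x\<close> has to be the only point in the intersection of all \<open>\<psi> F\<close>, where \<open>F\<close> is a
compact regular closed neighbourhood of \<open>x\<close>.  The intersection is nonempty by compactness.  Its
uniqueness rests on the right adjoint \<open>\<psi>\<^sub>P\<close>: if \<open>y\<close> lies in the
intersection and in the interior of \<open>G\<close>, then the lifting condition on \<open>\<psi>\<close> makes every neighbourhood
of \<open>x\<close> meet \<open>\<psi>\<^sub>P G\<close>, whence \<open>x\<close> belongs to \<open>\<psi>\<^sub>P G\<close>; since \<open>\<psi>\<close> preserves contact, two disjoint sets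
\<open>G\<close> cannot both arise.  The same observation, combined with compactness once more, shows that the map
induces \<open>\<psi>\<close> and that preimages of compact sets are compact.

For essential surjectivity, the points of the dual space of an algebra are abstract
neighbourhood filters: proper filters that are round, contain a bounded element, and decide every
pair \<open>a \<lless> b\<close>.  A prime ideal that omits some bounded element yields such a filter (\<open>prime_ideal_point\<close>),
and every existence statement about points rests on this.  It gives a common point of the sets that belong
to two elements in contact and compactness of the sets that belong to bounded elements, and thereby an
isomorphism of the algebra with the regular closed algebra of its dual space (\<open>rc_representation_dual_space\<close>).

All statements about algebras of regular closed sets are made for an algebra \<open>L\<close> that merely
\<^emph>\<open>represents\<close> them through a bijection (locale \<open>rc_representation\<close>).  The algebra of a space coded inside the
universe and an abstract algebra together with its dual space are both of this kind, and the
isomorphism between two algebras that represent the same space is the one induced by the identity map.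
\<close>

(* The theory of equivalence structures uses the same notation for the saturation of a set under eq; without it,
   closure_of parses unambiguously as topological closure. *)
no_notation Congruence.eq_closure_of (\<open>closure'_of\<index>\<close>)

section \<open>Equivalences from full, faithful and essentially surjective functors\<close>

text \<open>
Choose for every object \<open>A\<close> of \<open>D\<close> an object \<open>g A\<close> of \<open>C\<close> and an isomorphism \<open>e A\<close> from \<open>F (g A)\<close> to \<open>A\<close>.
The quasi-inverse acts on an arrow by conjugating it with these isomorphisms and lifting
the result along \<open>F\<close>; the isomorphisms \<open>e\<close> are then natural by construction, and the lifts of their inverses
form the other natural isomorphism.
\<close>

lemma equivalent_categoriesI:
  assumes "category C" and "category D" and F: "is_functor C D F"
    and ff: "\<And>X Y. \<lbrakk>X \<in> Obj C; Y \<in> Obj C\<rbrakk>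
      \<Longrightarrow> bij_betw (fmap F X Y) (Hom C X Y) (Hom D (fobj F X) (fobj F Y))"
    and ess: "\<And>A. A \<in> Obj D \<Longrightarrow> \<exists>X \<in> Obj C. \<exists>i. iso_arrow D (fobj F X) A i"
  shows "equivalent_categories C D"
proof -
  interpret C: category C by fact
  interpret D: category D by fact
  have Fobj [simp]: "fobj F X \<in> Obj D" if "X \<in> Obj C" for X
    using F that unfolding is_functor_def by blast
  have Fmap: "fmap F X Y f \<in> Hom D (fobj F X) (fobj F Y)"
    if "X \<in> Obj C" "Y \<in> Obj C" "f \<in> Hom C X Y" for X Y f
    using F that unfolding is_functor_def by blast
  have Fid: "fmap F X X (Ident C X) = Ident D (fobj F X)" if "X \<in> Obj C" for X
    using F that unfolding is_functor_def by blast
  have Fcomp: "fmap F X Z (Comp C X Y Z g f) =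
      Comp D (fobj F X) (fobj F Y) (fobj F Z) (fmap F Y Z g) (fmap F X Y f)"
    if "X \<in> Obj C" "Y \<in> Obj C" "Z \<in> Obj C" "f \<in> Hom C X Y" "g \<in> Hom C Y Z" for X Y Z f g
    using F that unfolding is_functor_def by blast
  have inj: "f = g" if "X \<in> Obj C" "Y \<in> Obj C" "f \<in> Hom C X Y" "g \<in> Hom C X Y"
    "fmap F X Y f = fmap F X Y g" for X Y f g
    using ff[OF that(1,2)] that(3-) unfolding bij_betw_def inj_on_def by blast
  \<comment> \<open>\<open>lift X Y\<close> is the inverse of the arrow part of \<open>F\<close>.\<close>
  define lift where "lift X Y = inv_into (Hom C X Y) (fmap F X Y)" for X Y
  have lift: "lift X Y h \<in> Hom C X Y" "fmap F X Y (lift X Y h) = h"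
    if "X \<in> Obj C" "Y \<in> Obj C" "h \<in> Hom D (fobj F X) (fobj F Y)" for X Y h
    using ff[OF that(1,2)] that(3) unfolding lift_def bij_betw_def
    by (metis inv_into_into, metis f_inv_into_f)
  have "\<forall>A. \<exists>X e e'. A \<in> Obj D \<longrightarrow> X \<in> Obj C \<and> e \<in> Hom D (fobj F X) A \<and> e' \<in> Hom D A (fobj F X) \<and>
      Comp D (fobj F X) A (fobj F X) e' e = Ident D (fobj F X) \<and>
      Comp D A (fobj F X) A e e' = Ident D A"
    using ess unfolding iso_arrow_def by meson
  then obtain g e e' where *: "\<And>A. A \<in> Obj D \<Longrightarrow> g A \<in> Obj C \<and> e A \<in> Hom D (fobj F (g A)) A \<and>
      e' A \<in> Hom D A (fobj F (g A)) \<and>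
      Comp D (fobj F (g A)) A (fobj F (g A)) (e' A) (e A) = Ident D (fobj F (g A)) \<and>
      Comp D A (fobj F (g A)) A (e A) (e' A) = Ident D A"
    by metis
  have g [simp]: "g A \<in> Obj C" and e: "e A \<in> Hom D (fobj F (g A)) A"
    and e': "e' A \<in> Hom D A (fobj F (g A))"
    and e'e: "Comp D (fobj F (g A)) A (fobj F (g A)) (e' A) (e A) = Ident D (fobj F (g A))"
    and ee': "Comp D A (fobj F (g A)) A (e A) (e' A) = Ident D A"
    if "A \<in> Obj D" for A
    using *[OF that] by blast+
  \<comment> \<open>\<open>conj A B h\<close> is the arrow from \<open>F (g A)\<close> to \<open>F (g B)\<close> that corresponds to \<open>h\<close>.\<close>
  define conj where "conj A B h = Comp D (fobj F (g A)) B (fobj F (g B)) (e' B)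
      (Comp D (fobj F (g A)) A B h (e A))" for A B h
  have conj: "conj A B h \<in> Hom D (fobj F (g A)) (fobj F (g B))"
    if "A \<in> Obj D" "B \<in> Obj D" "h \<in> Hom D A B" for A B h
    unfolding conj_def using that
    by (intro D.Comp_in_Hom[of _ B] D.Comp_in_Hom[of _ A] e e') auto
  have e_conj: "Comp D (fobj F (g A)) (fobj F (g B)) B (e B) (conj A B h) =
      Comp D (fobj F (g A)) A B h (e A)"
    if AB: "A \<in> Obj D" "B \<in> Obj D" and h: "h \<in> Hom D A B" for A B h
  proof -
    have c: "Comp D (fobj F (g A)) A B h (e A) \<in> Hom D (fobj F (g A)) B"
      using AB h by (intro D.Comp_in_Hom[of _ A] e) auto
    show ?thesis
      unfolding conj_def
      using AB c by (simp add: D.Comp_assoc[of _ B "fobj F (g B)" B] e e' ee' D.Ident_Comp)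
  qed
  have conj_e': "Comp D A (fobj F (g A)) (fobj F (g B)) (conj A B h) (e' A) =
      Comp D A B (fobj F (g B)) (e' B) h"
    if AB: "A \<in> Obj D" "B \<in> Obj D" and h: "h \<in> Hom D A B" for A B h
  proof -
    have c: "Comp D (fobj F (g A)) A B h (e A) \<in> Hom D (fobj F (g A)) B"
      using AB h by (intro D.Comp_in_Hom[of _ A] e) auto
    have "Comp D A (fobj F (g A)) (fobj F (g B)) (conj A B h) (e' A) =
      Comp D A B (fobj F (g B)) (e' B) (Comp D A (fobj F (g A)) B (Comp D (fobj F (g A)) A B h (e A)) (e' A))"
      unfolding conj_def
      by (rule D.Comp_assoc[symmetric]) (use AB c e e' in auto)
    also have "Comp D A (fobj F (g A)) B (Comp D (fobj F (g A)) A B h (e A)) (e' A) =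
        Comp D A A B h (Comp D A (fobj F (g A)) A (e A) (e' A))"
      by (rule D.Comp_assoc[symmetric]) (use AB h e e' in auto)
    also have "\<dots> = h"
      using AB h by (simp add: ee' D.Comp_Ident)
    finally show ?thesis .
  qed
  define G where "G = \<lparr>fobj = g, fmap = \<lambda>A B h. lift (g A) (g B) (conj A B h)\<rparr>"
  have G [simp]: "fobj G A = g A" "fmap G A B h = lift (g A) (g B) (conj A B h)" for A B h
    by (simp_all add: G_def)
  have G_Ident: "fmap G A A (Ident D A) = Ident C (g A)" if A: "A \<in> Obj D" for A
  proof (rule inj[of "g A" "g A"])
    have i: "Ident D A \<in> Hom D A A" using A by (rule D.Ident_in_Hom)
    show "fmap G A A (Ident D A) \<in> Hom C (g A) (g A)"
      using A i by (simp add: lift conj)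
    have "conj A A (Ident D A) = Ident D (fobj F (g A))"
      unfolding conj_def using A by (simp add: D.Ident_Comp e e'e)
    then show "fmap F (g A) (g A) (fmap G A A (Ident D A)) = fmap F (g A) (g A) (Ident C (g A))"
      using A i lift(2)[of "g A" "g A" "conj A A (Ident D A)"] conj[OF A A i] by (simp add: Fid)
  qed (use A C.Ident_in_Hom in auto)
  have G_Comp: "fmap G A B (Comp D A E B k h) = Comp C (g A) (g E) (g B) (fmap G E B k) (fmap G A E h)"
    if A: "A \<in> Obj D" "E \<in> Obj D" "B \<in> Obj D" and h: "h \<in> Hom D A E" and k: "k \<in> Hom D E B"
    for A E B h k
  proof (rule inj[of "g A" "g B"])
    have kh: "Comp D A E B k h \<in> Hom D A B" using A h k by (rule D.Comp_in_Hom)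
    show "fmap G A B (Comp D A E B k h) \<in> Hom C (g A) (g B)"
      using A kh by (simp add: lift conj)
    show "Comp C (g A) (g E) (g B) (fmap G E B k) (fmap G A E h) \<in> Hom C (g A) (g B)"
      using A h k by (intro C.Comp_in_Hom) (auto simp: lift conj)
    have ch: "conj A E h \<in> Hom D (fobj F (g A)) (fobj F (g E))"
      and ck: "Comp D (fobj F (g E)) E B k (e E) \<in> Hom D (fobj F (g E)) B"
      and hA: "Comp D (fobj F (g A)) A E h (e A) \<in> Hom D (fobj F (g A)) E"
      using A h k by (auto intro!: conj D.Comp_in_Hom[of "fobj F (g E)" E] D.Comp_in_Hom[of "fobj F (g A)" A] e)
    have "Comp D (fobj F (g A)) (fobj F (g E)) (fobj F (g B)) (conj E B k) (conj A E h) =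
        Comp D (fobj F (g A)) B (fobj F (g B)) (e' B)
          (Comp D (fobj F (g A)) (fobj F (g E)) B (Comp D (fobj F (g E)) E B k (e E)) (conj A E h))"
      unfolding conj_def[of E B]
      by (rule D.Comp_assoc[symmetric]) (use A ch ck e' in auto)
    also have "Comp D (fobj F (g A)) (fobj F (g E)) B (Comp D (fobj F (g E)) E B k (e E)) (conj A E h) =
        Comp D (fobj F (g A)) E B k (Comp D (fobj F (g A)) (fobj F (g E)) E (e E) (conj A E h))"
      by (rule D.Comp_assoc[symmetric]) (use A ch k e in auto)
    also have "\<dots> = Comp D (fobj F (g A)) A B (Comp D A E B k h) (e A)"
      using A h k by (simp add: e_conj D.Comp_assoc e)
    finally have "conj A B (Comp D A E B k h) =
        Comp D (fobj F (g A)) (fobj F (g E)) (fobj F (g B)) (conj E B k) (conj A E h)"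
      by (simp add: conj_def)
    then show "fmap F (g A) (g B) (fmap G A B (Comp D A E B k h)) =
        fmap F (g A) (g B) (Comp C (g A) (g E) (g B) (fmap G E B k) (fmap G A E h))"
      using A h k kh lift(2)[of "g A" "g B" "conj A B (Comp D A E B k h)"] conj[OF A(1,3) kh]
      by (simp add: lift conj Fcomp)
  qed (use A in auto)
  have "is_functor D C G"
    unfolding is_functor_def using G_Ident G_Comp by (auto simp: lift conj)
  moreover have "natural_iso C C id_functor (comp_functor G F) (\<lambda>X. lift X (g (fobj F X)) (e' (fobj F X)))"
    unfolding natural_iso_def
  proof (intro conjI ballI)
    fix X assume X: "X \<in> Obj C"
    let ?A = "fobj F X"
    let ?i = "lift X (g ?A) (e' ?A)" and ?j = "lift (g ?A) X (e ?A)"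
    have i: "?i \<in> Hom C X (g ?A)" and j: "?j \<in> Hom C (g ?A) X"
      using X by (auto intro!: lift e e')
    have "Comp C X (g ?A) X ?j ?i = Ident C X"
    proof (rule inj[of X X])
      show "fmap F X X (Comp C X (g ?A) X ?j ?i) = fmap F X X (Ident C X)"
        using X i j by (simp add: Fcomp Fid lift e e' ee')
    qed (use X i j in \<open>auto intro!: C.Comp_in_Hom[of X "g ?A"] C.Ident_in_Hom\<close>)
    moreover have "Comp C (g ?A) X (g ?A) ?i ?j = Ident C (g ?A)"
    proof (rule inj[of "g ?A" "g ?A"])
      show "fmap F (g ?A) (g ?A) (Comp C (g ?A) X (g ?A) ?i ?j) = fmap F (g ?A) (g ?A) (Ident C (g ?A))"
        using X i j by (simp add: Fcomp Fid lift e e' e'e)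
    qed (use X i j in \<open>auto intro!: C.Comp_in_Hom[of _ X] C.Ident_in_Hom\<close>)
    ultimately show "iso_arrow C (fobj id_functor X) (fobj (comp_functor G F) X) ?i"
      unfolding iso_arrow_def using i j by (auto simp: id_functor_def comp_functor_def)
  next
    fix X Y f assume X: "X \<in> Obj C" and Y: "Y \<in> Obj C" and f: "f \<in> Hom C X Y"
    let ?A = "fobj F X" and ?B = "fobj F Y"
    let ?i = "lift X (g ?A) (e' ?A)" and ?j = "lift Y (g ?B) (e' ?B)"
    let ?h = "lift (g ?A) (g ?B) (conj ?A ?B (fmap F X Y f))"
    have i: "?i \<in> Hom C X (g ?A)" and j: "?j \<in> Hom C Y (g ?B)" and h: "?h \<in> Hom C (g ?A) (g ?B)"
      using X Y f by (auto intro!: lift e e' conj Fmap)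
    have "Comp C X Y (g ?B) ?j f = Comp C X (g ?A) (g ?B) ?h ?i"
    proof (rule inj[of X "g ?B"])
      show "fmap F X (g ?B) (Comp C X Y (g ?B) ?j f) = fmap F X (g ?B) (Comp C X (g ?A) (g ?B) ?h ?i)"
        using X Y f i j h by (simp add: Fcomp lift e' conj Fmap conj_e')
    qed (use X Y f i j h in \<open>auto intro!: C.Comp_in_Hom[of X Y] C.Comp_in_Hom[of X "g ?A"]\<close>)
    then show "Comp C (fobj id_functor X) (fobj id_functor Y) (fobj (comp_functor G F) Y) ?j
          (fmap id_functor X Y f) =
        Comp C (fobj id_functor X) (fobj (comp_functor G F) X) (fobj (comp_functor G F) Y)
          (fmap (comp_functor G F) X Y f) ?i"
      by (simp add: id_functor_def comp_functor_def)
  qed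
  moreover have "natural_iso D D (comp_functor F G) id_functor e"
    unfolding natural_iso_def
  proof (intro conjI ballI)
    fix A assume A: "A \<in> Obj D"
    then show "iso_arrow D (fobj (comp_functor F G) A) (fobj id_functor A) (e A)"
      unfolding iso_arrow_def id_functor_def comp_functor_def using e[OF A] e'[OF A] e'e[OF A] ee'[OF A]
      by auto
  next
    fix A B h assume "A \<in> Obj D" "B \<in> Obj D" "h \<in> Hom D A B"
    then show "Comp D (fobj (comp_functor F G) A) (fobj (comp_functor F G) B) (fobj id_functor B) (e B)
          (fmap (comp_functor F G) A B h) =
        Comp D (fobj (comp_functor F G) A) (fobj id_functor A) (fobj id_functor B)
          (fmap id_functor A B h) (e A)"
      by (simp add: id_functor_def comp_functor_def lift conj e_conj)
  qed
  ultimately show ?thesis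
    unfolding equivalent_categories_def using assms(1,2) F by blast
qed

section \<open>Boolean lattices and prime ideals\<close>

context boolean_lattice
begin

abbreviation compl :: "'a \<Rightarrow> 'a" where "compl \<equiv> complement L"

lemma bottom_iff: "a \<in> carrier L \<Longrightarrow> a \<sqsubseteq> \<bottom> \<longleftrightarrow> a = \<bottom>"
  by (meson bottom_closed bottom_lower le_antisym le_refl)

lemma join_bot: "a \<in> carrier L \<Longrightarrow> a \<squnion> \<bottom> = a"
  using le_iff_meet[of \<bottom> a] join_comm[of L a \<bottom>] by simp

lemma meet_top: "a \<in> carrier L \<Longrightarrow> a \<sqinter> \<top> = a"
  using le_iff_join[of a \<top>] by simp

lemma le_meet_iff:
  "\<lbrakk>a \<in> carrier L; b \<in> carrier L; c \<in> carrier L\<rbrakk> \<Longrightarrow> a \<sqsubseteq> b \<sqinter> c \<longleftrightarrow> a \<sqsubseteq> b \<and> a \<sqsubseteq> c"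
  by (meson meet_closed meet_le meet_left meet_right le_trans)

lemma join_le_iff:
  "\<lbrakk>a \<in> carrier L; b \<in> carrier L; c \<in> carrier L\<rbrakk> \<Longrightarrow> b \<squnion> c \<sqsubseteq> a \<longleftrightarrow> b \<sqsubseteq> a \<and> c \<sqsubseteq> a"
  by (meson join_closed join_le join_left join_right le_trans)

lemma join_mono_left:
  assumes "a \<in> carrier L" "b \<in> carrier L" "c \<in> carrier L"
  shows "a \<squnion> c \<sqsubseteq> (a \<squnion> b) \<squnion> c"
  using assms join_left[of a b] join_left[of "a \<squnion> b" c] join_right[of "a \<squnion> b" c]
    le_trans[of a "a \<squnion> b" "(a \<squnion> b) \<squnion> c"]
  by (simp add: join_le_iff[of _ a c])

lemma join_distrib:
  assumes "a \<in> carrier L" "b \<in> carrier L" "c \<in> carrier L"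
  shows "a \<squnion> (b \<sqinter> c) = (a \<squnion> b) \<sqinter> (a \<squnion> c)"
proof -
  have "(a \<squnion> b) \<sqinter> (a \<squnion> c) = ((a \<squnion> b) \<sqinter> a) \<squnion> ((a \<squnion> b) \<sqinter> c)"
    using assms by (simp add: meet_join_distrib)
  also have "(a \<squnion> b) \<sqinter> a = a"
    using assms le_iff_join[of a "a \<squnion> b"] join_left[of a b] meet_comm[of L a "a \<squnion> b"] by simp
  also have "(a \<squnion> b) \<sqinter> c = (a \<sqinter> c) \<squnion> (b \<sqinter> c)"
    using assms meet_join_distrib[of c a b] by (simp add: meet_comm[of L c])
  also have "a \<squnion> ((a \<sqinter> c) \<squnion> (b \<sqinter> c)) = (a \<squnion> (a \<sqinter> c)) \<squnion> (b \<sqinter> c)"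
    using assms by (simp add: join_assoc)
  also have "a \<squnion> (a \<sqinter> c) = a"
    using assms le_iff_meet[of "a \<sqinter> c" a] meet_left[of a c] join_comm[of L a "a \<sqinter> c"] by simp
  finally show ?thesis ..
qed

text \<open>
One direction of the uniqueness of complements, stated as an inequality so that antisymmetry yields
uniqueness and a single use yields a criterion for lying below a complement.
\<close>

lemma complement_unique:
  assumes "a \<in> carrier L" "b \<in> carrier L" "c \<in> carrier L"
    and "a \<sqinter> b = \<bottom>" "a \<squnion> c = \<top>"
  shows "b \<sqsubseteq> c"
proof -
  have "b = b \<sqinter> (a \<squnion> c)"
    using assms by (simp add: meet_top)
  also have "\<dots> = b \<sqinter> c"
    using assms by (metis meet_join_distrib meet_comm bottom_closed join_comm join_bot meet_closed)
  finally show ?thesis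
    using assms by (metis meet_right)
qed

lemma complement_props:
  assumes a: "a \<in> carrier L"
  shows complement_closed [simp]: "compl a \<in> carrier L"
    and meet_compl: "a \<sqinter> compl a = \<bottom>" and join_compl: "a \<squnion> compl a = \<top>"
proof -
  have "\<exists>!b. b \<in> carrier L \<and> a \<sqinter> b = \<bottom> \<and> a \<squnion> b = \<top>"
    using complemented[OF a] complement_unique[OF a] by (metis le_antisym)
  from theI'[OF this] show "compl a \<in> carrier L" "a \<sqinter> compl a = \<bottom>" "a \<squnion> compl a = \<top>"
    unfolding complement_def by auto
qed

lemma complement_eqI:
  assumes "a \<in> carrier L" "b \<in> carrier L" "a \<sqinter> b = \<bottom>" "a \<squnion> b = \<top>"
  shows "compl a = b"
  using assms complement_props[OF assms(1)] complement_unique[OF assms(1)] by (metis le_antisym)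

lemma compl_compl [simp]: "a \<in> carrier L \<Longrightarrow> compl (compl a) = a"
  by (rule complement_eqI) (simp_all add: meet_compl join_compl meet_comm join_comm)

lemma le_compl_iff:
  assumes "a \<in> carrier L" "b \<in> carrier L"
  shows "a \<sqsubseteq> compl b \<longleftrightarrow> a \<sqinter> b = \<bottom>"
proof
  assume "a \<sqsubseteq> compl b"
  then have "a \<sqinter> b \<sqsubseteq> compl b" "a \<sqinter> b \<sqsubseteq> b"
    using assms by (auto intro: le_trans[OF meet_left] meet_right)
  then have "a \<sqinter> b \<sqsubseteq> b \<sqinter> compl b"
    using assms by (simp add: le_meet_iff)
  then show "a \<sqinter> b = \<bottom>"
    using assms by (simp add: meet_compl bottom_iff)
next
  assume "a \<sqinter> b = \<bottom>"
  then show "a \<sqsubseteq> compl b"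
    using assms by (intro complement_unique[of b]) (simp_all add: meet_comm join_compl)
qed

lemma le_iff_meet_compl:
  "\<lbrakk>a \<in> carrier L; b \<in> carrier L\<rbrakk> \<Longrightarrow> a \<sqsubseteq> b \<longleftrightarrow> a \<sqinter> compl b = \<bottom>"
  using le_compl_iff[of a "compl b"] by simp

lemma compl_antimono_iff:
  "\<lbrakk>a \<in> carrier L; b \<in> carrier L\<rbrakk> \<Longrightarrow> compl a \<sqsubseteq> compl b \<longleftrightarrow> b \<sqsubseteq> a"
  by (simp add: le_compl_iff le_iff_meet_compl meet_comm)

lemma compl_top [simp]: "compl \<top> = \<bottom>"
  by (rule complement_eqI) (simp_all add: meet_top join_bot meet_comm)

lemma compl_bottom [simp]: "compl \<bottom> = \<top>"
  by (metis compl_top compl_compl top_closed)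

lemma compl_meet:
  assumes "a \<in> carrier L" "b \<in> carrier L"
  shows "compl (a \<sqinter> b) = compl a \<squnion> compl b"
proof (rule le_antisym)
  show "compl (a \<sqinter> b) \<sqsubseteq> compl a \<squnion> compl b"
  proof -
    have "compl (compl a \<squnion> compl b) \<sqsubseteq> a" "compl (compl a \<squnion> compl b) \<sqsubseteq> b"
      using assms by (metis complement_closed join_closed join_left join_right compl_antimono_iff compl_compl)+
    then have "compl (compl a \<squnion> compl b) \<sqsubseteq> a \<sqinter> b"
      using assms by (simp add: le_meet_iff)
    then show ?thesis
      using assms by (metis compl_antimono_iff compl_compl complement_closed join_closed meet_closed)
  qed
  show "compl a \<squnion> compl b \<sqsubseteq> compl (a \<sqinter> b)"
    using assms by (simp add: join_le_iff compl_antimono_iff meet_left meet_right)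
qed (use assms in auto)

lemma compl_join:
  assumes "a \<in> carrier L" "b \<in> carrier L"
  shows "compl (a \<squnion> b) = compl a \<sqinter> compl b"
  using compl_meet[of "compl a" "compl b"] assms
  by (metis compl_compl complement_closed meet_closed)

text \<open>
Prime ideals take the place of ultrafilters: the complement of a prime ideal is an ultrafilter, and in
the applications it is an ideal that has to be avoided.
\<close>

definition prime_ideal :: "'a set \<Rightarrow> bool" where
  "prime_ideal J \<longleftrightarrow> lattice_ideal L J \<and> \<top> \<notin> J \<and>
     (\<forall>a \<in> carrier L. \<forall>b \<in> carrier L. a \<sqinter> b \<in> J \<longrightarrow> a \<in> J \<or> b \<in> J)"

lemma lattice_idealD:
  assumes "lattice_ideal L I"
  shows "I \<subseteq> carrier L" "\<bottom> \<in> I" "\<And>a b. \<lbrakk>a \<in> I; b \<in> carrier L; b \<sqsubseteq> a\<rbrakk> \<Longrightarrow> b \<in> I"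
    "\<And>a b. \<lbrakk>a \<in> I; b \<in> I\<rbrakk> \<Longrightarrow> a \<squnion> b \<in> I"
  using assms unfolding lattice_ideal_def by blast+

lemma lattice_ideal_adjoin:
  assumes I: "lattice_ideal L I" and x: "x \<in> carrier L"
  shows "lattice_ideal L {z \<in> carrier L. \<exists>y \<in> I. z \<sqsubseteq> y \<squnion> x}" (is "lattice_ideal L ?K")
  unfolding lattice_ideal_def
proof (intro conjI ballI impI)
  note I = lattice_idealD[OF I]
  show "\<bottom> \<in> ?K"
    using x by (auto intro!: bexI[OF _ I(2)])
  fix a assume a: "a \<in> ?K"
  then obtain y where y: "y \<in> I" "y \<in> carrier L" "a \<in> carrier L" "a \<sqsubseteq> y \<squnion> x" using I(1) by blast
  { fix b assume "b \<in> carrier L" "b \<sqsubseteq> a"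
    then show "b \<in> ?K" using y x le_trans[of b a "y \<squnion> x"] by auto }
  fix b assume b: "b \<in> ?K"
  then obtain y' where y': "y' \<in> I" "y' \<in> carrier L" "b \<in> carrier L" "b \<sqsubseteq> y' \<squnion> x" using I(1) by blast
  have le: "y \<squnion> x \<sqsubseteq> (y \<squnion> y') \<squnion> x" "y' \<squnion> x \<sqsubseteq> (y \<squnion> y') \<squnion> x"
    using x y y' join_mono_left[of y y' x] join_mono_left[of y' y x] by (simp_all add: join_comm[of L y' y])
  have "a \<squnion> b \<sqsubseteq> (y \<squnion> y') \<squnion> x"
    using x y y' le le_trans[of a "y \<squnion> x" "(y \<squnion> y') \<squnion> x"] le_trans[of b "y' \<squnion> x" "(y \<squnion> y') \<squnion> x"]
    by (simp add: join_le_iff[of _ a b])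
  then show "a \<squnion> b \<in> ?K" using I(4)[OF y(1) y'(1)] y y' by auto
qed auto

text \<open>
The prime ideal theorem.  By Zorn's lemma there is an ideal \<open>J\<close> that is maximal among those avoiding
\<open>a\<close>.  If neither \<open>x\<close> nor \<open>y\<close> were in \<open>J\<close>, adjoining either of them would capture \<open>a\<close>, and by
distributivity adjoining \<open>x \<sqinter> y\<close> would do so as well.
\<close>

lemma prime_ideal_exists:
  assumes I: "lattice_ideal L I" and a: "a \<in> carrier L" "a \<notin> I"
  obtains J where "prime_ideal J" "I \<subseteq> J" "a \<notin> J"
proof -
  define \<A> where "\<A> = {K. lattice_ideal L K \<and> I \<subseteq> K \<and> a \<notin> K}"
  have "\<exists>M \<in> \<A>. \<forall>K \<in> \<A>. M \<subseteq> K \<longrightarrow> K = M"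
  proof (rule subset_Zorn_nonempty)
    show "\<A> \<noteq> {}" using assms unfolding \<A>_def by blast
    fix \<C> assume ne: "\<C> \<noteq> {}" and ch: "subset.chain \<A> \<C>"
    have C: "\<And>K. K \<in> \<C> \<Longrightarrow> lattice_ideal L K \<and> I \<subseteq> K \<and> a \<notin> K"
      using ch unfolding subset_chain_def \<A>_def by blast
    have lin: "\<And>K K'. K \<in> \<C> \<Longrightarrow> K' \<in> \<C> \<Longrightarrow> K \<subseteq> K' \<or> K' \<subseteq> K"
      using ch unfolding subset_chain_def by blast
    have "lattice_ideal L (\<Union>\<C>)"
      unfolding lattice_ideal_def
    proof (intro conjI ballI impI)
      show "\<Union>\<C> \<subseteq> carrier L" "\<bottom> \<in> \<Union>\<C>"
        using C ne lattice_idealD(1,2) by blast+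
      fix x assume x: "x \<in> \<Union>\<C>"
      { fix y assume "y \<in> carrier L" "y \<sqsubseteq> x"
        then show "y \<in> \<Union>\<C>" using x C lattice_idealD(3) by blast }
      fix y assume "y \<in> \<Union>\<C>"
      then obtain K where "K \<in> \<C>" "x \<in> K" "y \<in> K" using x lin by blast
      then show "x \<squnion> y \<in> \<Union>\<C>" using C lattice_idealD(4) by blast
    qed
    then show "\<Union>\<C> \<in> \<A>" using C ne unfolding \<A>_def by blast
  qed
  then obtain J where JA: "J \<in> \<A>" and maxA: "\<forall>K \<in> \<A>. J \<subseteq> K \<longrightarrow> K = J" ..
  then have J: "lattice_ideal L J" "I \<subseteq> J" "a \<notin> J"
    and max: "\<And>K. \<lbrakk>lattice_ideal L K; I \<subseteq> K; a \<notin> K; J \<subseteq> K\<rbrakk> \<Longrightarrow> K = J"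
    unfolding \<A>_def by simp_all
  note JD = lattice_idealD[OF J(1)]
  \<comment> \<open>By maximality, adjoining an element outside \<open>J\<close> captures \<open>a\<close>.\<close>
  have adj: "\<exists>y \<in> J. a \<sqsubseteq> y \<squnion> x" if x: "x \<in> carrier L" "x \<notin> J" for x
  proof (rule ccontr)
    let ?K = "{z \<in> carrier L. \<exists>y \<in> J. z \<sqsubseteq> y \<squnion> x}"
    assume "\<not> ?thesis"
    moreover have "J \<subseteq> ?K" using JD(1) x by (auto intro!: bexI join_left)
    moreover have "x \<in> ?K" using JD(1,2) x by (auto intro!: bexI[of _ "\<bottom>"] join_right)
    ultimately show False using max[of ?K] lattice_ideal_adjoin[OF J(1) x(1)] J(2) x(2) by blast
  qed
  have "x \<in> J \<or> y \<in> J" if xy: "x \<in> carrier L" "y \<in> carrier L" "x \<sqinter> y \<in> J" for x y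
  proof (rule ccontr)
    assume "\<not> ?thesis"
    then have "x \<notin> J" "y \<notin> J" by simp_all
    then obtain u v where u: "u \<in> J" "a \<sqsubseteq> u \<squnion> x" and v: "v \<in> J" "a \<sqsubseteq> v \<squnion> y"
      using adj[OF xy(1)] adj[OF xy(2)] by auto
    have c: "u \<in> carrier L" "v \<in> carrier L" using u v JD(1) by auto
    have "a \<sqsubseteq> (u \<squnion> v) \<squnion> x" "a \<sqsubseteq> (u \<squnion> v) \<squnion> y"
      using c xy a join_mono_left[of u v x] join_mono_left[of v u y]
        le_trans[OF u(2), of "(u \<squnion> v) \<squnion> x"] le_trans[OF v(2), of "(u \<squnion> v) \<squnion> y"]
      by (simp_all add: join_comm[of L v u])
    then have "a \<sqsubseteq> (u \<squnion> v) \<squnion> (x \<sqinter> y)"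
      using c xy a by (simp add: join_distrib le_meet_iff)
    then show False using JD(3)[OF JD(4)[OF JD(4)[OF u(1) v(1)] xy(3)] a(1)] J(3) by blast
  qed
  moreover have "\<top> \<notin> J" using JD(3)[of \<top> a] a J(3) by auto
  ultimately have "prime_ideal J" unfolding prime_ideal_def using J(1) by blast
  with J that show ?thesis by blast
qed

end

section \<open>Contact, non-tangential inclusion and points\<close>

context contact_algebra
begin

lemma contact_closed: "(a, b) \<in> contact L \<Longrightarrow> a \<in> carrier L" "(a, b) \<in> contact L \<Longrightarrow> b \<in> carrier L"
  using contact_on_carrier by auto

lemma contact_mono_right:
  assumes "(a, b) \<in> contact L" "b \<sqsubseteq> c" "c \<in> carrier L"
  shows "(a, c) \<in> contact L"
  using assms C4[of a b c] contact_closed[OF assms(1)] le_iff_meet[of b c] by simp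

lemma contact_mono:
  assumes "(a, b) \<in> contact L" "a \<sqsubseteq> a'" "b \<sqsubseteq> b'" "a' \<in> carrier L" "b' \<in> carrier L"
  shows "(a', b') \<in> contact L"
  using contact_mono_right[OF C3[OF contact_mono_right[OF assms(1,3,5)]] assms(2,4)] by (rule C3)

lemma nt_le:
  assumes "a \<lless> b" "a \<in> carrier L" "b \<in> carrier L"
  shows "a \<sqsubseteq> b"
proof (rule ccontr)
  assume "\<not> a \<sqsubseteq> b"
  then have "a \<sqinter> compl b \<noteq> \<bottom>"
    using assms by (simp add: le_iff_meet_compl)
  then have "(a \<sqinter> compl b, a \<sqinter> compl b) \<in> contact L"
    using assms by (intro C1) auto
  then have "(a, compl b) \<in> contact L"
    by (rule contact_mono) (use assms meet_left[of a "compl b"] meet_right[of a "compl b"] in auto)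
  then show False
    using assms(1) by (simp add: non_tangential_def)
qed

lemma nt_mono:
  assumes "a \<lless> b" "a' \<sqsubseteq> a" "b \<sqsubseteq> b'"
    and "a \<in> carrier L" "b \<in> carrier L" "b' \<in> carrier L"
  shows "a' \<lless> b'"
  unfolding non_tangential_def
proof
  assume "(a', compl b') \<in> contact L"
  then have "(a, compl b) \<in> contact L"
    by (rule contact_mono) (use assms in \<open>auto simp: compl_antimono_iff\<close>)
  then show False
    using assms(1) by (simp add: non_tangential_def)
qed

lemma nt_compl:
  assumes "a \<lless> b" "a \<in> carrier L" "b \<in> carrier L"
  shows "compl b \<lless> compl a"
  using assms C3 unfolding non_tangential_def by auto

lemma nt_meet:
  assumes "a \<lless> b" "a \<lless> c" "a \<in> carrier L" "b \<in> carrier L" "c \<in> carrier L"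
  shows "a \<lless> b \<sqinter> c"
  using assms C4[of a "compl b" "compl c"] unfolding non_tangential_def by (simp add: compl_meet)

lemma nt_top: "a \<lless> \<top>"
  using C2 unfolding non_tangential_def by fastforce

end

context local_contact_algebra
begin

text \<open>
In the regular closed algebra of a space, the sets whose interior contains a fixed \<open>x\<close> form a filter
with these properties: it is round because the space is regular, it has a bounded member because
the space is locally compact, and if \<open>F\<close> lies in the interior of \<open>G\<close>, then \<open>x\<close> is either outside \<open>F\<close> or inside the
interior of \<open>G\<close>.
\<close>

definition point :: "'a set \<Rightarrow> bool" where
  "point p \<longleftrightarrow> p \<subseteq> carrier L \<and> (\<forall>a \<in> p. \<forall>b \<in> carrier L. a \<sqsubseteq> b \<longrightarrow> b \<in> p) \<and>
     (\<forall>a \<in> p. \<forall>b \<in> p. a \<sqinter> b \<in> p) \<and> \<bottom> \<notin> p \<and>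
     (\<forall>a \<in> p. \<exists>b \<in> p. b \<lless> a) \<and> (\<exists>b \<in> p. b \<in> bdd L) \<and>
     (\<forall>a \<in> carrier L. \<forall>b \<in> carrier L. a \<lless> b \<longrightarrow> compl a \<in> p \<or> b \<in> p)"

lemma bdd_closed: "a \<in> bdd L \<Longrightarrow> a \<in> carrier L"
  using ideal lattice_idealD(1) by blast

lemma bdd_down: "\<lbrakk>a \<in> bdd L; b \<in> carrier L; b \<sqsubseteq> a\<rbrakk> \<Longrightarrow> b \<in> bdd L"
  using lattice_idealD(3)[OF ideal] by simp

lemma pointD:
  assumes "point p"
  shows "\<And>a. a \<in> p \<Longrightarrow> a \<in> carrier L"
    and "\<And>a b. \<lbrakk>a \<in> p; a \<sqsubseteq> b; b \<in> carrier L\<rbrakk> \<Longrightarrow> b \<in> p"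
    and "\<And>a b. \<lbrakk>a \<in> p; b \<in> p\<rbrakk> \<Longrightarrow> a \<sqinter> b \<in> p"
    and "\<bottom> \<notin> p"
    and "\<And>a. a \<in> p \<Longrightarrow> \<exists>b \<in> p. b \<lless> a"
    and "\<exists>b \<in> p. b \<in> bdd L"
    and "\<And>a b. \<lbrakk>a \<in> carrier L; b \<in> carrier L; a \<lless> b\<rbrakk> \<Longrightarrow> compl a \<in> p \<or> b \<in> p"
  using assms unfolding point_def by auto

lemma point_compl:
  assumes "point p" "a \<in> p"
  shows "compl a \<notin> p"
  using pointD(1)[OF assms] pointD(3)[OF assms(1,2), of "compl a"] pointD(4)[OF assms(1)]
  by (auto simp: meet_compl)

lemma point_meet_iff:
  assumes "point p" "a \<in> carrier L" "b \<in> carrier L"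
  shows "a \<sqinter> b \<in> p \<longleftrightarrow> a \<in> p \<and> b \<in> p"
  using pointD(2,3)[OF assms(1)] assms meet_left[of a b] meet_right[of a b] by auto

text \<open>
The elements lying non-tangentially above some member of the ultrafilter \<open>- J\<close> form a point.
The bounded member of the ultrafilter is essential, because interpolation is available only below
bounded elements: cutting down with it makes the filter round, and it reduces the
decision of \<open>a \<lless> c\<close> for arbitrary \<open>a\<close> to bounded \<open>a\<close>.
\<close>

lemma prime_ideal_point:
  assumes J: "prime_ideal J" and b: "b \<in> bdd L" "b \<notin> J"
  shows "point {a \<in> carrier L. \<exists>d \<in> carrier L. d \<notin> J \<and> d \<lless> a}" (is "point ?p")
proof -
  note bc = bdd_closed[OF b(1)]
  have idl: "lattice_ideal L J"
    and pr: "\<And>a b. \<lbrakk>a \<in> carrier L; b \<in> carrier L; a \<notin> J; b \<notin> J\<rbrakk> \<Longrightarrow> a \<sqinter> b \<notin> J"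
    and top: "\<top> \<notin> J"
    using J unfolding prime_ideal_def by auto
  note JD = lattice_idealD[OF idl]
  have compl_J: "compl a \<notin> J" if "a \<in> carrier L" "a \<in> J" for a
    using JD(4)[of a "compl a"] that top by (auto simp: join_compl)
  \<comment> \<open>The witness \<open>d\<close> may always be chosen bounded, namely below \<open>b\<close>.\<close>
  have below_b: "\<exists>d \<in> carrier L. d \<notin> J \<and> d \<in> bdd L \<and> d \<lless> a" if "a \<in> ?p" for a
  proof -
    from that obtain d where d: "d \<in> carrier L" "d \<notin> J" "d \<lless> a" and a: "a \<in> carrier L" by auto
    have "d \<sqinter> b \<notin> J" using pr d b bc by simp
    moreover have "d \<sqinter> b \<in> bdd L" using bdd_down[OF b(1), of "d \<sqinter> b"] d bc meet_right[of d b] by simp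
    moreover have "d \<sqinter> b \<lless> a" using nt_mono[OF d(3), of "d \<sqinter> b" a] d a bc meet_left[of d b] by simp
    ultimately show ?thesis using d bc by (intro bexI[of _ "d \<sqinter> b"]) auto
  qed
  have up: "c \<in> ?p" if "a \<in> ?p" "a \<sqsubseteq> c" "c \<in> carrier L" for a c
    using that nt_mono[where b = a and b' = c] by (auto intro: bexI[OF _])
  have meet: "a \<sqinter> c \<in> ?p" if "a \<in> ?p" "c \<in> ?p" for a c
  proof -
    from that obtain d e where d: "d \<in> carrier L" "d \<notin> J" "d \<lless> a" "a \<in> carrier L"
      and e: "e \<in> carrier L" "e \<notin> J" "e \<lless> c" "c \<in> carrier L" by auto
    have "d \<sqinter> e \<lless> a" "d \<sqinter> e \<lless> c"
      using nt_mono[OF d(3), of "d \<sqinter> e" a] nt_mono[OF e(3), of "d \<sqinter> e" c] d e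
        meet_left[of d e] meet_right[of d e] by simp_all
    then show ?thesis
      using d e pr by (auto intro!: bexI[of _ "d \<sqinter> e"] nt_meet)
  qed
  have round: "\<exists>e \<in> ?p. e \<in> bdd L \<and> e \<lless> a" if a: "a \<in> ?p" for a
  proof -
    obtain d where d: "d \<in> carrier L" "d \<notin> J" "d \<in> bdd L" "d \<lless> a" using below_b[OF a] by auto
    obtain e where "e \<in> bdd L" "d \<lless> e" "e \<lless> a" using BC1[OF d(3) _ d(4)] a by auto
    then show ?thesis using d bdd_closed[of e] by blast
  qed
  have "\<top> \<in> ?p" using top nt_top by auto
  then have bdd: "\<exists>e \<in> ?p. e \<in> bdd L" using round by blast
  have prime: "compl a \<in> ?p \<or> c \<in> ?p" if a: "a \<in> bdd L" and c: "c \<in> carrier L" and ac: "a \<lless> c" for a c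
  proof -
    obtain e where e: "e \<in> bdd L" "a \<lless> e" "e \<lless> c" using BC1[OF a c ac] by auto
    note ca = bdd_closed[OF a] bdd_closed[OF e(1)]
    show ?thesis
    proof (cases "e \<in> J")
      case True
      then show ?thesis using compl_J[of e] nt_compl[OF e(2)] ca by (auto intro!: bexI[of _ "compl e"])
    next
      case False
      then show ?thesis using e ca c by auto
    qed
  qed
  have prime': "compl a \<in> ?p \<or> c \<in> ?p" if a: "a \<in> carrier L" and c: "c \<in> carrier L" and ac: "a \<lless> c" for a c
  proof -
    obtain d where d: "d \<in> ?p" "d \<in> bdd L" using bdd by auto
    note dc = bdd_closed[OF d(2)]
    have "compl (d \<sqinter> a) \<in> ?p \<or> c \<in> ?p"
      using prime[of "d \<sqinter> a" c] bdd_down[OF d(2), of "d \<sqinter> a"] nt_mono[OF ac, of "d \<sqinter> a" c]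
        meet_left[of d a] meet_right[of d a] dc a c by simp
    moreover have "compl a \<in> ?p" if "compl (d \<sqinter> a) \<in> ?p"
    proof (rule up)
      show "d \<sqinter> compl (d \<sqinter> a) \<in> ?p" using meet d(1) that by simp
      have "d \<sqinter> compl (d \<sqinter> a) = d \<sqinter> compl a"
        using dc a by (simp add: compl_meet meet_join_distrib meet_compl join_comm[of L \<bottom>] join_bot)
      then show "d \<sqinter> compl (d \<sqinter> a) \<sqsubseteq> compl a" using dc a by (simp add: meet_right)
    qed (use a in simp)
    ultimately show ?thesis by blast
  qed
  have "\<bottom> \<notin> ?p"
  proof
    assume "\<bottom> \<in> ?p"
    then obtain d where "d \<in> carrier L" "d \<notin> J" "d \<lless> \<bottom>" by auto
    then show False using nt_le[of d \<bottom>] JD(2) by (simp add: bottom_iff)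
  qed
  moreover have "\<forall>a \<in> ?p. \<exists>e \<in> ?p. e \<lless> a"
  proof
    fix a assume "a \<in> ?p"
    from round[OF this] obtain e where "e \<in> ?p" "e \<lless> a" by (elim bexE conjE)
    then show "\<exists>e \<in> ?p. e \<lless> a" ..
  qed
  moreover have "?p \<subseteq> carrier L" by (rule Collect_restrict)
  moreover have "\<forall>a \<in> ?p. \<forall>c \<in> carrier L. a \<sqsubseteq> c \<longrightarrow> c \<in> ?p"
    by (intro ballI impI) (rule up)
  moreover have "\<forall>a \<in> ?p. \<forall>c \<in> ?p. a \<sqinter> c \<in> ?p"
    by (intro ballI) (rule meet)
  moreover have "\<forall>a \<in> carrier L. \<forall>c \<in> carrier L. a \<lless> c \<longrightarrow> compl a \<in> ?p \<or> c \<in> ?p"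
    by (intro ballI impI) (rule prime')
  ultimately show ?thesis
    unfolding point_def using bdd by (intro conjI)
qed

text \<open>
The elements not in contact with \<open>a\<close> form an ideal, which omits \<open>b\<close>.  After \<open>b\<close> has been replaced by a bounded element
that is still in contact with \<open>a\<close>, a prime ideal extending it yields the point.
\<close>

lemma contact_imp_point:
  assumes "(a, b) \<in> contact L"
  obtains p where "point p" "compl a \<notin> p" "compl b \<notin> p"
proof -
  note ab = contact_closed[OF assms]
  obtain c where c: "c \<in> bdd L" "(a, c \<sqinter> b) \<in> contact L" using BC2[OF assms] by auto
  define b' where "b' = c \<sqinter> b"
  have b': "b' \<in> bdd L" "b' \<in> carrier L" "b' \<sqsubseteq> b" "(a, b') \<in> contact L"
    using c bdd_closed[OF c(1)] ab meet_right[of c b] meet_left[of c b] bdd_down[OF c(1), of b'] unfolding b'_def by auto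
  let ?I = "{x \<in> carrier L. (a, x) \<notin> contact L}"
  have "lattice_ideal L ?I"
    unfolding lattice_ideal_def
  proof (intro conjI ballI impI)
    show "\<bottom> \<in> ?I" using C2[of a \<bottom>] by auto
    fix x assume x: "x \<in> ?I"
    { fix y assume "y \<in> carrier L" "y \<sqsubseteq> x"
      then show "y \<in> ?I" using x contact_mono_right[of a y x] by auto }
    fix y assume "y \<in> ?I"
    then show "x \<squnion> y \<in> ?I" using x C4[OF ab(1), of x y] by auto
  qed auto
  then obtain J where J: "prime_ideal J" "?I \<subseteq> J" "b' \<notin> J"
    using prime_ideal_exists[of ?I b'] b' by auto
  let ?p = "{x \<in> carrier L. \<exists>d \<in> carrier L. d \<notin> J \<and> d \<lless> x}"
  have "point ?p" using prime_ideal_point[OF J(1) b'(1) J(3)] .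
  moreover have "compl a \<notin> ?p"
  proof
    assume "compl a \<in> ?p"
    then obtain d where "d \<in> carrier L" "d \<notin> J" "(d, a) \<notin> contact L"
      unfolding non_tangential_def using ab by auto
    then show False using J(2) C3 by blast
  qed
  moreover have "compl b \<notin> ?p"
  proof
    assume "compl b \<in> ?p"
    then obtain d where d: "d \<in> carrier L" "d \<notin> J" "d \<lless> compl b" by auto
    then have "d \<sqsubseteq> compl b'"
      using nt_le[OF d(3)] ab b' le_trans[of d "compl b" "compl b'"] by (simp add: compl_antimono_iff)
    then have "d \<sqinter> b' = \<bottom>" using d b' by (simp add: le_compl_iff)
    then show False
      using J(1,3) d b' lattice_idealD(2) unfolding prime_ideal_def by metis
  qed
  ultimately show ?thesis using that by blast
qed

text \<open>
A nonzero bounded \<open>b \<lless> c\<close> is in contact with itself; the resulting point does not contain the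
complement of \<open>b\<close>, so it contains \<open>c\<close>.
\<close>

lemma nonzero_imp_point:
  assumes c: "c \<in> carrier L" "c \<noteq> \<bottom>"
  obtains p where "point p" "c \<in> p"
proof -
  obtain b where b: "b \<in> bdd L" "b \<noteq> \<bottom>" "b \<lless> c" using BC3[OF c] by auto
  note bc = bdd_closed[OF b(1)]
  obtain p where p: "point p" "compl b \<notin> p" using contact_imp_point[OF C1[OF bc b(2)]] by auto
  then show ?thesis using that[OF p(1)] pointD(7)[OF p(1) bc c(1) b(3)] by auto
qed

end

section \<open>Regular closed sets\<close>

definition regular_closed :: "'x topology \<Rightarrow> 'x set set" where
  "regular_closed X = {F. X closure_of (X interior_of F) = F}"

lemma closure_of_open_regular_closed:
  assumes "openin X U" shows "X closure_of U \<in> regular_closed X"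
proof -
  have "U \<subseteq> X interior_of (X closure_of U)"
    using assms by (simp add: closure_of_subset interior_of_maximal openin_subset)
  then have "X closure_of U \<subseteq> X closure_of (X interior_of (X closure_of U))"
    by (rule closure_of_mono)
  moreover have "X closure_of (X interior_of (X closure_of U)) \<subseteq> X closure_of U"
    by (simp add: closure_of_minimal interior_of_subset)
  ultimately show ?thesis
    unfolding regular_closed_def by blast
qed

lemma regular_closedD:
  assumes "F \<in> regular_closed X"
  shows "X closure_of (X interior_of F) = F" "closedin X F" "F \<subseteq> topspace X"
proof -
  show F: "X closure_of (X interior_of F) = F"
    using assms unfolding regular_closed_def by simp
  then show "closedin X F" by (metis closedin_closure_of)
  then show "F \<subseteq> topspace X" by (rule closedin_subset)
qed

text \<open>
Joins of regular closed sets are closures of unions, here for arbitrary families.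
\<close>

lemma closure_of_Union_regular_closed:
  assumes "\<F> \<subseteq> regular_closed X"
  shows "X closure_of (\<Union>\<F>) \<in> regular_closed X"
proof -
  have "F \<subseteq> X closure_of (\<Union>F \<in> \<F>. X interior_of F)" if "F \<in> \<F>" for F
    using that assms regular_closedD(1)[of F X]
    by (metis UN_upper closure_of_mono subsetD)
  then have "X closure_of (\<Union>\<F>) \<subseteq> X closure_of (\<Union>F \<in> \<F>. X interior_of F)"
    by (meson Union_least closedin_closure_of closure_of_minimal)
  moreover have "X closure_of (\<Union>F \<in> \<F>. X interior_of F) \<subseteq> X closure_of (\<Union>\<F>)"
    using interior_of_subset by (intro closure_of_mono) fast
  ultimately have "X closure_of (\<Union>\<F>) = X closure_of (\<Union>F \<in> \<F>. X interior_of F)"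
    by (rule subset_antisym)
  then show ?thesis
    by (metis closure_of_open_regular_closed imageE openin_Union openin_interior_of)
qed

text \<open>
The intersection of two regular closed sets need not be regular closed; their meet is the largest
regular closed set in it.
\<close>

definition regular_meet :: "'x topology \<Rightarrow> 'x set \<Rightarrow> 'x set \<Rightarrow> 'x set" where
  "regular_meet X F G = X closure_of (X interior_of F \<inter> X interior_of G)"

lemma regular_meet_regular_closed [simp]: "regular_meet X F G \<in> regular_closed X"
  unfolding regular_meet_def by (intro closure_of_open_regular_closed openin_Int openin_interior_of)

lemma subset_regular_meet_iff:
  assumes "F \<in> regular_closed X" "G \<in> regular_closed X" "H \<in> regular_closed X"
  shows "H \<subseteq> regular_meet X F G \<longleftrightarrow> H \<subseteq> F \<and> H \<subseteq> G"
proof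
  have "regular_meet X F G \<subseteq> X closure_of (X interior_of F)" "regular_meet X F G \<subseteq> X closure_of (X interior_of G)"
    unfolding regular_meet_def by (auto intro!: closure_of_mono)
  then show "H \<subseteq> regular_meet X F G \<Longrightarrow> H \<subseteq> F \<and> H \<subseteq> G"
    using assms by (auto simp: regular_closedD(1))
next
  assume "H \<subseteq> F \<and> H \<subseteq> G"
  then have "X interior_of H \<subseteq> X interior_of F \<inter> X interior_of G"
    by (simp add: interior_of_mono)
  then show "H \<subseteq> regular_meet X F G"
    unfolding regular_meet_def by (metis assms(3) closure_of_mono regular_closedD(1))
qed

text \<open>
For closed sets, interior distributes over unions up to closure: an open set inside \<open>F \<union> G\<close> that misses
the interior of \<open>G\<close> is contained in \<open>F\<close>, since its part outside \<open>F\<close> is open and contained in \<open>G\<close>.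
\<close>

lemma interior_Un_closed_subset:
  assumes "closedin X F" "closedin X G"
  shows "X interior_of (F \<union> G) \<subseteq> X closure_of (X interior_of F \<union> X interior_of G)"
proof -
  have "X interior_of (F \<union> G) - X closure_of (X interior_of F \<union> X interior_of G) \<subseteq> X interior_of G"
  proof -
    let ?W = "X interior_of (F \<union> G) - X closure_of (X interior_of F \<union> X interior_of G)"
    have W: "openin X ?W" by (intro openin_diff) auto
    have "?W - F \<subseteq> X interior_of G"
      using W assms(1) interior_of_subset[of X "F \<union> G"] by (intro interior_of_maximal openin_diff) auto
    moreover have dis: "?W \<inter> (X interior_of F \<union> X interior_of G) = {}"
      using closure_of_subset[of "X interior_of F \<union> X interior_of G" X] interior_of_subset_topspace by fast
    ultimately have "?W \<subseteq> F" by blast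
    then have "?W \<subseteq> X interior_of F" using W by (rule interior_of_maximal)
    then show ?thesis using dis by blast
  qed
  moreover have "X interior_of G \<subseteq> X closure_of (X interior_of F \<union> X interior_of G)"
    using closure_of_subset[of "X interior_of F \<union> X interior_of G" X] interior_of_subset_topspace[of X F]
      interior_of_subset_topspace[of X G] by simp
  ultimately show ?thesis by blast
qed

lemma regular_meet_Un_distrib:
  assumes "F \<in> regular_closed X" "G \<in> regular_closed X" "H \<in> regular_closed X"
  shows "regular_meet X F (G \<union> H) = regular_meet X F G \<union> regular_meet X F H"
proof
  have "X interior_of F \<inter> X interior_of (G \<union> H) \<subseteq>
      X interior_of F \<inter> X closure_of (X interior_of G \<union> X interior_of H)"
    using interior_Un_closed_subset[of X G H] assms regular_closedD(2) by blast
  also have "\<dots> \<subseteq> X closure_of (X interior_of F \<inter> (X interior_of G \<union> X interior_of H))"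
    by (rule openin_Int_closure_of_subset) simp
  also have "\<dots> = regular_meet X F G \<union> regular_meet X F H"
    unfolding regular_meet_def by (simp add: Int_Un_distrib)
  finally show "regular_meet X F (G \<union> H) \<subseteq> regular_meet X F G \<union> regular_meet X F H"
    unfolding regular_meet_def[of X F "G \<union> H"] by (rule closure_of_minimal) (simp add: regular_meet_def closedin_Un)
  show "regular_meet X F G \<union> regular_meet X F H \<subseteq> regular_meet X F (G \<union> H)"
    unfolding regular_meet_def by (intro Un_least closure_of_mono Int_mono interior_of_mono order_refl) auto
qed

lemma complement_regular_closed:
  assumes "F \<in> regular_closed X"
  shows "topspace X - X interior_of F \<in> regular_closed X"
  using closure_of_open_regular_closed[of X "topspace X - F"] regular_closedD(2)[OF assms]
  by (simp add: closure_of_complement openin_diff)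

lemma regular_meet_complement:
  assumes "F \<in> regular_closed X"
  shows "regular_meet X F (topspace X - X interior_of F) = {}"
  unfolding regular_meet_def
  by (simp add: interior_of_complement regular_closedD(1)[OF assms])
     (metis Diff_disjoint Int_Diff Int_empty_left closure_of_empty inf.absorb_iff1 inf_commute interior_of_subset)

lemma regular_closed_empty_iff:
  assumes "F \<in> regular_closed X" shows "X interior_of F = {} \<longleftrightarrow> F = {}"
  using regular_closedD(1)[OF assms] by (metis closure_of_empty interior_of_empty)

lemma empty_regular_closed: "{} \<in> regular_closed X"
  and topspace_regular_closed: "topspace X \<in> regular_closed X"
  by (simp_all add: regular_closed_def)

text \<open>
Cover the compact set by open sets with compact hulls inside \<open>U\<close>; the closure of a finite subcover is
regular closed, and it stays within the union of the hulls because that union is closed.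
\<close>

lemma regular_closed_nbhd:
  assumes X: "locally_compact_space X" "Hausdorff_space X"
    and K: "compactin X K" and U: "openin X U" "K \<subseteq> U"
  obtains F where "F \<in> regular_closed X" "compactin X F" "K \<subseteq> X interior_of F" "F \<subseteq> U"
proof -
  have "neighbourhood_base_of (compactin X) X"
    using X by (simp add: locally_compact_space_neighbourhood_base)
  then have "\<forall>x \<in> K. \<exists>V C. openin X V \<and> compactin X C \<and> x \<in> V \<and> V \<subseteq> C \<and> C \<subseteq> U"
    using U unfolding neighbourhood_base_of by blast
  then obtain V C where VC: "\<And>x. x \<in> K \<Longrightarrow> openin X (V x) \<and> compactin X (C x) \<and> x \<in> V x \<and> V x \<subseteq> C x \<and> C x \<subseteq> U"
    by metis
  have "Ball (V ` K) (openin X)" "K \<subseteq> \<Union>(V ` K)" using VC by auto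
  then obtain \<F> where "finite \<F>" "\<F> \<subseteq> V ` K" "K \<subseteq> \<Union>\<F>"
    using K unfolding compactin_def by meson
  then obtain S where S: "finite S" "S \<subseteq> K" "K \<subseteq> \<Union>(V ` S)"
    by (metis finite_subset_image)
  define F where "F = X closure_of (\<Union>(V ` S))"
  have comp: "compactin X (\<Union>(C ` S))" using S VC by (intro compactin_Union) auto
  have "\<Union>(V ` S) \<subseteq> \<Union>(C ` S)" using S VC by blast
  then have FC: "F \<subseteq> \<Union>(C ` S)"
    unfolding F_def using comp X(2) by (intro closure_of_minimal compactin_imp_closedin)
  have op: "openin X (\<Union>(V ` S))" using S VC by (intro openin_Union) auto
  show ?thesis
  proof
    show "F \<in> regular_closed X" unfolding F_def by (rule closure_of_open_regular_closed[OF op])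
    show "compactin X F" using comp FC by (rule closed_compactin) (simp add: F_def)
    have "\<Union>(V ` S) \<subseteq> X interior_of F"
      unfolding F_def using op by (simp add: closure_of_subset interior_of_maximal openin_subset)
    then show "K \<subseteq> X interior_of F" using S(3) by blast
    show "F \<subseteq> U" using FC S VC by blast
  qed
qed

lemma regular_closed_point_nbhd:
  assumes X: "locally_compact_space X" "Hausdorff_space X" and U: "openin X U" "x \<in> U"
  obtains F where "F \<in> regular_closed X" "compactin X F" "x \<in> X interior_of F" "F \<subseteq> U"
proof -
  have "compactin X {x}" using U openin_subset[OF U(1)] by auto
  then obtain F where "F \<in> regular_closed X" "compactin X F" "{x} \<subseteq> X interior_of F" "F \<subseteq> U"
    by (rule regular_closed_nbhd[OF X _ U(1)]) (use U in auto)
  then show ?thesis by (intro that) auto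
qed


section \<open>The dual space of a local contact algebra\<close>

context local_contact_algebra
begin

text \<open>
The sets \<open>nbhd a\<close> are the basic open sets, and \<open>region a\<close> is the closure of \<open>nbhd a\<close>
(\<open>closure_of_nbhd\<close>), that is, the regular closed set that the element \<open>a\<close> stands for.
\<close>

definition nbhd :: "'a \<Rightarrow> 'a set set" where "nbhd a = {p. point p \<and> a \<in> p}"

definition region :: "'a \<Rightarrow> 'a set set" where "region a = {p. point p \<and> compl a \<notin> p}"

definition dual_space :: "'a set topology" where
  "dual_space = topology (\<lambda>U. U \<subseteq> Collect point \<and> (\<forall>p \<in> U. \<exists>a \<in> p. nbhd a \<subseteq> U))"

lemma openin_dual_space:
  "openin dual_space U \<longleftrightarrow> U \<subseteq> Collect point \<and> (\<forall>p \<in> U. \<exists>a \<in> p. nbhd a \<subseteq> U)"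
proof -
  have "istopology (\<lambda>U. U \<subseteq> Collect point \<and> (\<forall>p \<in> U. \<exists>a \<in> p. nbhd a \<subseteq> U))"
    unfolding istopology_def
  proof (intro conjI allI impI)
    fix S T assume S: "S \<subseteq> Collect point \<and> (\<forall>p \<in> S. \<exists>a \<in> p. nbhd a \<subseteq> S)"
      and T: "T \<subseteq> Collect point \<and> (\<forall>p \<in> T. \<exists>a \<in> p. nbhd a \<subseteq> T)"
    show "S \<inter> T \<subseteq> Collect point" using S by blast
    show "\<forall>p \<in> S \<inter> T. \<exists>a \<in> p. nbhd a \<subseteq> S \<inter> T"
    proof
      fix p assume p: "p \<in> S \<inter> T"
      then obtain a b where a: "a \<in> p" "nbhd a \<subseteq> S" and b: "b \<in> p" "nbhd b \<subseteq> T" and pp: "point p"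
        using S T by (metis IntE mem_Collect_eq subsetD)
      have "nbhd (a \<sqinter> b) \<subseteq> nbhd a \<inter> nbhd b"
        using pointD(1)[OF pp a(1)] pointD(1)[OF pp b(1)] point_meet_iff unfolding nbhd_def by auto
      then show "\<exists>c \<in> p. nbhd c \<subseteq> S \<inter> T"
        using a b pointD(3)[OF pp a(1) b(1)] by blast
    qed
  next
    fix \<K> assume "\<forall>K \<in> \<K>. K \<subseteq> Collect point \<and> (\<forall>p \<in> K. \<exists>a \<in> p. nbhd a \<subseteq> K)"
    then show "\<Union>\<K> \<subseteq> Collect point" "\<forall>p \<in> \<Union>\<K>. \<exists>a \<in> p. nbhd a \<subseteq> \<Union>\<K>"
      by (blast, meson Union_iff Union_upper subset_trans)
  qed
  then show ?thesis unfolding dual_space_def by (simp add: topology_inverse')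
qed

lemma nbhd_subset: "nbhd a \<subseteq> Collect point"
  unfolding nbhd_def by blast

lemma openin_nbhd: "openin dual_space (nbhd a)"
  unfolding openin_dual_space using nbhd_subset by (auto simp: nbhd_def)

lemma topspace_dual_space [simp]: "topspace dual_space = Collect point"
proof -
  have "openin dual_space (Collect point)"
    unfolding openin_dual_space using nbhd_subset pointD(6) by blast
  then show ?thesis
    using openin_dual_space[of "topspace dual_space"] openin_subset[of dual_space "Collect point"] by blast
qed

lemma nbhd_eq_empty_iff:
  assumes "a \<in> carrier L" shows "nbhd a = {} \<longleftrightarrow> a = \<bottom>"
  using nonzero_imp_point[OF assms] pointD(4) unfolding nbhd_def by blast

lemma nbhd_meet: "\<lbrakk>a \<in> carrier L; b \<in> carrier L\<rbrakk> \<Longrightarrow> nbhd (a \<sqinter> b) = nbhd a \<inter> nbhd b"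
  using point_meet_iff unfolding nbhd_def by blast

lemma in_closure_of_dual_space:
  "p \<in> dual_space closure_of S \<longleftrightarrow> point p \<and> (\<forall>a \<in> p. nbhd a \<inter> S \<noteq> {})"
proof
  assume L: "p \<in> dual_space closure_of S"
  have "nbhd a \<inter> S \<noteq> {}" if "a \<in> p" for a
  proof -
    have "point p" using L by (simp add: in_closure_of)
    then have "p \<in> nbhd a" using that by (simp add: nbhd_def)
    then show ?thesis using L openin_nbhd[of a] unfolding in_closure_of by (meson disjoint_iff)
  qed
  then show "point p \<and> (\<forall>a \<in> p. nbhd a \<inter> S \<noteq> {})"
    using L by (simp add: in_closure_of)
next
  assume R: "point p \<and> (\<forall>a \<in> p. nbhd a \<inter> S \<noteq> {})"
  have "\<exists>q. q \<in> S \<and> q \<in> T" if T: "p \<in> T" "openin dual_space T" for T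
  proof -
    obtain a where "a \<in> p" "nbhd a \<subseteq> T" using T unfolding openin_dual_space by meson
    then show ?thesis using R by (meson disjoint_iff subsetD)
  qed
  then show "p \<in> dual_space closure_of S"
    unfolding in_closure_of using R by simp
qed

text \<open>
A point \<open>p\<close> adheres to \<open>nbhd a\<close> when no \<open>b \<in> p\<close> is disjoint from \<open>a\<close>, because disjointness of \<open>nbhd b\<close> and
\<open>nbhd a\<close> amounts to \<open>b \<sqsubseteq> compl a\<close> by the existence of points.
\<close>

lemma closure_of_nbhd:
  assumes a: "a \<in> carrier L"
  shows "dual_space closure_of (nbhd a) = region a"
proof -
  have "(\<forall>b \<in> p. nbhd b \<inter> nbhd a \<noteq> {}) \<longleftrightarrow> compl a \<notin> p" if p: "point p" for p
  proof -
    have "nbhd b \<inter> nbhd a = {} \<longleftrightarrow> b \<sqsubseteq> compl a" if "b \<in> p" for b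
      using a pointD(1)[OF p that] by (simp add: nbhd_meet[symmetric] nbhd_eq_empty_iff le_compl_iff)
    then show ?thesis
      using a pointD(2)[OF p, of _ "compl a"] by (metis complement_closed le_refl)
  qed
  then show ?thesis
    by (auto simp: in_closure_of_dual_space region_def)
qed

lemma nbhd_subset_region: "nbhd a \<subseteq> region a"
  using point_compl unfolding nbhd_def region_def by blast

lemma region_subset_nbhd:
  "\<lbrakk>a \<lless> b; a \<in> carrier L; b \<in> carrier L\<rbrakk> \<Longrightarrow> region a \<subseteq> nbhd b"
  using pointD(7) unfolding nbhd_def region_def by blast

lemma region_subset_iff:
  assumes a: "a \<in> carrier L" and b: "b \<in> carrier L"
  shows "region a \<subseteq> region b \<longleftrightarrow> a \<sqsubseteq> b"
proof
  assume sub: "region a \<subseteq> region b"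
  show "a \<sqsubseteq> b"
  proof (rule ccontr)
    assume "\<not> a \<sqsubseteq> b"
    then have "a \<sqinter> compl b \<noteq> \<bottom>" using a b by (simp add: le_iff_meet_compl)
    then obtain p where "point p" "a \<in> p" "compl b \<in> p"
      using nonzero_imp_point[of "a \<sqinter> compl b"] a b point_meet_iff
      by (metis complement_closed meet_closed)
    then show False using sub point_compl unfolding region_def by blast
  qed
next
  assume "a \<sqsubseteq> b"
  then have "compl b \<sqsubseteq> compl a" using a b by (simp add: compl_antimono_iff)
  then show "region a \<subseteq> region b"
    using a pointD(2) unfolding region_def by auto
qed

lemma region_join:
  assumes "a \<in> carrier L" "b \<in> carrier L"
  shows "region (a \<squnion> b) = region a \<union> region b"
  using assms point_meet_iff[of _ "compl a" "compl b"] unfolding region_def by (auto simp: compl_join)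

text \<open>
A point in both regions refutes \<open>a \<lless> compl b\<close>, since it would have to contain \<open>compl a\<close> or \<open>compl b\<close>.
\<close>

lemma contact_iff_regions_meet:
  assumes "a \<in> carrier L" "b \<in> carrier L"
  shows "(a, b) \<in> contact L \<longleftrightarrow> region a \<inter> region b \<noteq> {}"
proof
  assume "(a, b) \<in> contact L"
  then obtain p where "point p" "compl a \<notin> p" "compl b \<notin> p" by (rule contact_imp_point)
  then have "p \<in> region a \<inter> region b" unfolding region_def by simp
  then show "region a \<inter> region b \<noteq> {}" by auto
next
  assume "region a \<inter> region b \<noteq> {}"
  then obtain p where p: "point p" "compl a \<notin> p" "compl b \<notin> p" unfolding region_def by blast
  then have "\<not> a \<lless> compl b" using pointD(7)[OF p(1), of a "compl b"] assms by auto
  then show "(a, b) \<in> contact L" using assms unfolding non_tangential_def by simp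
qed

text \<open>
If \<open>a\<close> is in \<open>p\<close> but not in \<open>q\<close>, roundness gives \<open>b \<lless> a\<close> in \<open>p\<close>, and then \<open>q\<close> contains \<open>compl b\<close>.
\<close>

lemma Hausdorff_dual_space: "Hausdorff_space dual_space"
  unfolding Hausdorff_space_def
proof (intro allI impI)
  have sep: "\<exists>U V. openin dual_space U \<and> openin dual_space V \<and> p \<in> U \<and> q \<in> V \<and> disjnt U V"
    if p: "point p" and q: "point q" and a: "a \<in> p" "a \<notin> q" for p q a
  proof -
    obtain b where b: "b \<in> p" "b \<lless> a" using pointD(5)[OF p a(1)] by blast
    have "compl b \<in> q" using pointD(7)[OF q pointD(1)[OF p b(1)] pointD(1)[OF p a(1)] b(2)] a by blast
    moreover have "nbhd b \<inter> nbhd (compl b) = {}" using point_compl unfolding nbhd_def by blast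
    ultimately show ?thesis
      using b p q openin_nbhd unfolding disjnt_def
      by (intro exI[of _ "nbhd b"] exI[of _ "nbhd (compl b)"]) (auto simp: nbhd_def)
  qed
  fix p q assume pq: "p \<in> topspace dual_space \<and> q \<in> topspace dual_space \<and> p \<noteq> q"
  then consider a where "a \<in> p" "a \<notin> q" | a where "a \<in> q" "a \<notin> p" by blast
  then show "\<exists>U V. openin dual_space U \<and> openin dual_space V \<and> p \<in> U \<and> q \<in> V \<and> disjnt U V"
  proof cases
    case 1 then show ?thesis using sep[of p q] pq by auto
  next
    case 2 then show ?thesis using sep[of q p] pq disjnt_sym by (metis mem_Collect_eq topspace_dual_space)
  qed
qed

text \<open>
Fix an open cover of \<open>region a\<close>.  The elements whose region is covered by finitely many members form an
ideal.  If it omitted \<open>a\<close>, a prime ideal extending it without \<open>a\<close> would give a point of \<open>region a\<close>; that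
point lies in some member of the cover, and by roundness it contains an element of the ideal, which is
impossible because every member of the point lies above an element outside the prime ideal.
\<close>

lemma compactin_region:
  assumes a: "a \<in> bdd L"
  shows "compactin dual_space (region a)"
  unfolding compactin_def
proof (intro conjI allI impI)
  note ac = bdd_closed[OF a]
  show "region a \<subseteq> topspace dual_space" unfolding region_def by auto
  fix \<U> assume cov: "Ball \<U> (openin dual_space) \<and> region a \<subseteq> \<Union>\<U>"
  let ?I = "{x \<in> carrier L. \<exists>\<F>. finite \<F> \<and> \<F> \<subseteq> \<U> \<and> region x \<subseteq> \<Union>\<F>}"
  have "a \<in> ?I"
  proof (rule ccontr)
    assume na: "a \<notin> ?I"
    have "lattice_ideal L ?I"
      unfolding lattice_ideal_def
    proof (intro conjI ballI impI)
      have "\<top> \<in> p" if p: "point p" for p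
      proof -
        obtain b where "b \<in> p" using pointD(6)[OF p] by auto
        then show ?thesis using pointD(2)[OF p _ top_higher top_closed] pointD(1)[OF p] by simp
      qed
      then have "region \<bottom> = {}" unfolding region_def by simp
      then show "\<bottom> \<in> ?I" by (auto intro: exI[of _ "{}"])
      fix x assume x: "x \<in> ?I"
      { fix y assume "y \<in> carrier L" "y \<sqsubseteq> x"
        then show "y \<in> ?I" using x region_subset_iff[of y x] by blast }
      fix y assume y: "y \<in> ?I"
      from x y obtain \<F> \<G> where "finite \<F>" "\<F> \<subseteq> \<U>" "region x \<subseteq> \<Union>\<F>" "finite \<G>" "\<G> \<subseteq> \<U>" "region y \<subseteq> \<Union>\<G>"
        by auto
      then have "finite (\<F> \<union> \<G>) \<and> \<F> \<union> \<G> \<subseteq> \<U> \<and> region (x \<squnion> y) \<subseteq> \<Union>(\<F> \<union> \<G>)"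
        using x y by (auto simp: region_join)
      moreover have "x \<squnion> y \<in> carrier L" using x y by simp
      ultimately show "x \<squnion> y \<in> ?I" by blast
    qed auto
    then obtain J where J: "prime_ideal J" "?I \<subseteq> J" "a \<notin> J"
      using prime_ideal_exists[OF _ ac na] by blast
    then have JD: "\<bottom> \<in> J" "\<And>x y. \<lbrakk>x \<in> J; y \<in> carrier L; y \<sqsubseteq> x\<rbrakk> \<Longrightarrow> y \<in> J"
      "\<And>x y. \<lbrakk>x \<in> carrier L; y \<in> carrier L; x \<sqinter> y \<in> J\<rbrakk> \<Longrightarrow> x \<in> J \<or> y \<in> J"
      unfolding prime_ideal_def lattice_ideal_def by auto
    let ?p = "{x \<in> carrier L. \<exists>d \<in> carrier L. d \<notin> J \<and> d \<lless> x}"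
    have p: "point ?p" using prime_ideal_point[OF J(1) a J(3)] .
    have "compl a \<notin> ?p"
    proof
      assume "compl a \<in> ?p"
      then obtain d where d: "d \<in> carrier L" "d \<notin> J" "d \<lless> compl a" by auto
      then have "d \<sqinter> a = \<bottom>" using nt_le[OF d(3)] ac by (simp add: le_compl_iff)
      then show False using JD(1) JD(3)[of d a] d J(3) ac by simp
    qed
    then have "?p \<in> region a" using p unfolding region_def by simp
    then obtain U where U: "U \<in> \<U>" "?p \<in> U" using cov by blast
    then have "\<exists>c \<in> ?p. nbhd c \<subseteq> U" using cov unfolding openin_dual_space by blast
    then obtain c where c: "c \<in> ?p" "nbhd c \<subseteq> U" ..
    obtain c' where c': "c' \<in> ?p" "c' \<lless> c" using pointD(5)[OF p c(1)] ..
    have "region c' \<subseteq> \<Union>{U}" using region_subset_nbhd[OF c'(2)] c c' by auto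
    then have "c' \<in> ?I" using c'(1) U(1) by (auto intro!: exI[of _ "{U}"])
    then have "c' \<in> J" using J(2) by blast
    moreover obtain d where d: "d \<in> carrier L" "d \<notin> J" "d \<lless> c'" using c'(1) by auto
    ultimately show False using JD(2)[of c' d] nt_le[OF d(3,1)] c'(1) by simp
  qed
  then show "\<exists>\<F>. finite \<F> \<and> \<F> \<subseteq> \<U> \<and> region a \<subseteq> \<Union>\<F>" by simp
qed

text \<open>
Conversely, a compact region is covered by finitely many \<open>nbhd d\<close> with \<open>d\<close> bounded, hence it lies in the
region of the join of these \<open>d\<close>.
\<close>

lemma compactin_region_iff:
  assumes a: "a \<in> carrier L"
  shows "compactin dual_space (region a) \<longleftrightarrow> a \<in> bdd L"
proof
  assume K: "compactin dual_space (region a)"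
  have "region a \<subseteq> \<Union>(nbhd ` bdd L)"
    using pointD(6) unfolding region_def nbhd_def by fastforce
  moreover have "Ball (nbhd ` bdd L) (openin dual_space)" using openin_nbhd by blast
  ultimately obtain \<F> where F: "finite \<F>" "\<F> \<subseteq> nbhd ` bdd L" "region a \<subseteq> \<Union>\<F>"
    using K unfolding compactin_def by meson
  have "\<exists>d \<in> bdd L. \<Union>\<F> \<subseteq> region d"
    using F(1,2)
  proof (induction \<F>)
    case empty
    then show ?case using lattice_idealD(2)[OF ideal] by auto
  next
    case (insert U \<F>)
    then obtain d b where d: "d \<in> bdd L" "\<Union>\<F> \<subseteq> region d" and b: "b \<in> bdd L" "U = nbhd b" by auto
    have "\<Union>(insert U \<F>) \<subseteq> region (b \<squnion> d)"
      using d b nbhd_subset_region[of b] bdd_closed by (auto simp: region_join)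
    then show ?case using lattice_idealD(4)[OF ideal b(1) d(1)] by blast
  qed
  then obtain d where d: "d \<in> bdd L" "\<Union>\<F> \<subseteq> region d" by (elim bexE)
  then have "a \<sqsubseteq> d" using region_subset_iff[OF a bdd_closed[OF d(1)]] subset_trans[OF F(3) d(2)] by simp
  with d(1) a show "a \<in> bdd L" by (rule bdd_down)
qed (rule compactin_region)

lemma locally_compact_dual_space: "locally_compact_space dual_space"
  unfolding locally_compact_space_def
proof
  fix p assume "p \<in> topspace dual_space"
  then obtain b where "b \<in> p" "b \<in> bdd L" "point p" using pointD(6) by auto
  then show "\<exists>U K. openin dual_space U \<and> compactin dual_space K \<and> p \<in> U \<and> U \<subseteq> K"
    using openin_nbhd compactin_region nbhd_subset_region
    by (intro exI[of _ "nbhd b"] exI[of _ "region b"]) (auto simp: nbhd_def)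
qed

end

context complete_local_contact_algebra
begin

text \<open>
The regular closed set \<open>F\<close> is the region of the join of all \<open>b\<close> whose basic open set lies inside \<open>F\<close>.  The
join adds nothing beyond the closure, because an element disjoint from all \<open>b\<close> is disjoint from
their join.
\<close>

lemma region_image: "region ` carrier L = regular_closed dual_space"
proof (intro equalityI subsetI)
  fix F assume "F \<in> region ` carrier L"
  then show "F \<in> regular_closed dual_space"
    using closure_of_open_regular_closed[OF openin_nbhd] by (auto simp: closure_of_nbhd[symmetric])
next
  fix F assume F: "F \<in> regular_closed dual_space"
  define U where "U = dual_space interior_of F"
  define S where "S = {b \<in> carrier L. nbhd b \<subseteq> U}"
  define a where "a = \<Squnion>S"
  have S: "S \<subseteq> carrier L" unfolding S_def by blast
  have a: "a \<in> carrier L" unfolding a_def using S by simp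
  have lub: "b \<sqsubseteq> a" if "b \<in> S" for b unfolding a_def using S that by (simp add: sup_upper)
  have least: "a \<sqsubseteq> c" if "c \<in> carrier L" "\<And>b. b \<in> S \<Longrightarrow> b \<sqsubseteq> c" for c
    unfolding a_def using S that by (intro sup_least) auto
  have FU: "F = dual_space closure_of U" using F unfolding U_def regular_closed_def by simp
  have "region a = dual_space closure_of U"
  proof
    have "U \<subseteq> region a"
    proof
      fix p assume p: "p \<in> U"
      have "openin dual_space U" unfolding U_def by simp
      then obtain b where b: "b \<in> p" "nbhd b \<subseteq> U" and pp: "point p"
        using p unfolding openin_dual_space by blast
      have "b \<in> S" unfolding S_def using b pointD(1)[OF pp] by blast
      then show "p \<in> region a"
        using b pp nbhd_subset_region[of b] region_subset_iff[of b a] lub a S unfolding nbhd_def by blast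
    qed
    then show "dual_space closure_of U \<subseteq> region a"
      by (metis closure_of_nbhd[OF a] closure_of_closure_of closure_of_mono)
    show "region a \<subseteq> dual_space closure_of U"
    proof
      fix p assume "p \<in> region a"
      then have p: "point p" "compl a \<notin> p" unfolding region_def by auto
      have "nbhd b \<inter> U \<noteq> {}" if b: "b \<in> p" for b
      proof -
        have bc: "b \<in> carrier L" using pointD(1)[OF p(1) b] .
        have "\<not> a \<sqsubseteq> compl b"
        proof
          assume "a \<sqsubseteq> compl b"
          then have "b \<sqsubseteq> compl a" using a bc by (simp add: le_compl_iff meet_comm)
          then show False using pointD(2)[OF p(1) b] a p(2) by simp
        qed
        then obtain s where s: "s \<in> S" "\<not> s \<sqsubseteq> compl b"
          using least[of "compl b"] bc complement_closed by blast
        then have "nbhd s \<inter> nbhd b \<noteq> {}"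
          using S bc by (auto simp: nbhd_meet[symmetric] nbhd_eq_empty_iff le_compl_iff)
        then show ?thesis using s(1) unfolding S_def by blast
      qed
      then show "p \<in> dual_space closure_of U" using p by (simp add: in_closure_of_dual_space)
    qed
  qed
  then show "F \<in> region ` carrier L" using a FU by blast
qed

end

section \<open>The regular closed algebra of a locally compact Hausdorff space\<close>

text \<open>
The algebra \<open>L\<close> is, up to the renaming \<open>r\<close> of its elements, the algebra of regular closed subsets of \<open>X\<close>.
The renaming is a parameter because the elements of \<open>L\<close> may live in any type: codes of sets
within a universe, or the elements of an abstract algebra.
\<close>

locale rc_representation =
  fixes X :: "'x topology" and L :: "'a local_contact_structure" (structure) and r :: "'a \<Rightarrow> 'x set"
  assumes locally_compact: "locally_compact_space X" and Hausdorff: "Hausdorff_space X"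
    and bij: "bij_betw r (carrier L) (regular_closed X)"
    and eq_equality: "(.=) = (=)"
    and le_iff: "\<lbrakk>a \<in> carrier L; b \<in> carrier L\<rbrakk> \<Longrightarrow> a \<sqsubseteq> b \<longleftrightarrow> r a \<subseteq> r b"
    and contact_eq: "contact L = {(a, b). a \<in> carrier L \<and> b \<in> carrier L \<and> r a \<inter> r b \<noteq> {}}"
    and bdd_eq: "bdd L = {a \<in> carrier L. compactin X (r a)}"
begin

definition code :: "'x set \<Rightarrow> 'a" where "code = inv_into (carrier L) r"

lemma regular: "a \<in> carrier L \<Longrightarrow> r a \<in> regular_closed X"
  using bij bij_betwE by blast

lemma r_eq_iff: "\<lbrakk>a \<in> carrier L; b \<in> carrier L\<rbrakk> \<Longrightarrow> r a = r b \<longleftrightarrow> a = b"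
  using bij unfolding bij_betw_def inj_on_def by blast

lemma code_closed: "F \<in> regular_closed X \<Longrightarrow> code F \<in> carrier L"
  unfolding code_def using bij by (metis bij_betw_def inv_into_into)

lemma r_code: "F \<in> regular_closed X \<Longrightarrow> r (code F) = F"
  unfolding code_def using bij by (metis bij_betw_def f_inv_into_f)

lemma code_r: "a \<in> carrier L \<Longrightarrow> code (r a) = a"
  unfolding code_def using bij by (simp add: bij_betw_def)

lemma r_closedin: "a \<in> carrier L \<Longrightarrow> closedin X (r a)"
  using regular regular_closedD(2) by blast

lemma partial_order: "partial_order L"
  by unfold_locales (auto simp: eq_equality le_iff r_eq_iff)

lemma Upper_iff: "u \<in> Upper L A \<longleftrightarrow> u \<in> carrier L \<and> (\<forall>a \<in> A \<inter> carrier L. r a \<subseteq> r u)"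
  unfolding Upper_def using le_iff by auto

lemma Lower_iff: "u \<in> Lower L A \<longleftrightarrow> u \<in> carrier L \<and> (\<forall>a \<in> A \<inter> carrier L. r u \<subseteq> r a)"
  unfolding Lower_def using le_iff by auto

lemma closure_Union_regular: "A \<subseteq> carrier L \<Longrightarrow> X closure_of \<Union>(r ` A) \<in> regular_closed X"
  using regular by (intro closure_of_Union_regular_closed) auto

lemma least_Upper:
  assumes A: "A \<subseteq> carrier L"
  shows "least L (code (X closure_of \<Union>(r ` A))) (Upper L A)"
proof -
  let ?F = "X closure_of \<Union>(r ` A)"
  have F: "code ?F \<in> carrier L" "r (code ?F) = ?F"
    using closure_Union_regular[OF A] code_closed r_code by auto
  have "\<Union>(r ` A) \<subseteq> topspace X"
    using A regular regular_closedD(3) by blast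
  then have "\<forall>a \<in> A. r a \<subseteq> ?F" using closure_of_subset[of "\<Union>(r ` A)" X] by blast
  moreover have "?F \<subseteq> r u" if "u \<in> carrier L" "\<forall>a \<in> A. r a \<subseteq> r u" for u
    using that r_closedin by (intro closure_of_minimal) auto
  ultimately show ?thesis
    unfolding least_def using A F by (simp add: Upper_iff le_iff Int_absorb2)
qed

lemma greatest_Lower:
  assumes A: "A \<subseteq> carrier L"
  shows "greatest L (code (X closure_of \<Union>(r ` Lower L A))) (Lower L A)"
proof -
  have sub: "Lower L A \<subseteq> carrier L" by (auto simp: Lower_iff)
  let ?F = "X closure_of \<Union>(r ` Lower L A)"
  have F: "code ?F \<in> carrier L" "r (code ?F) = ?F"
    using closure_Union_regular[OF sub] code_closed r_code by auto
  have "\<Union>(r ` Lower L A) \<subseteq> topspace X"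
    using sub regular regular_closedD(3) by blast
  then have "\<forall>a \<in> Lower L A. r a \<subseteq> ?F" using closure_of_subset[of "\<Union>(r ` Lower L A)" X] by blast
  moreover have "?F \<subseteq> r u" if "u \<in> A" for u
    using that A r_closedin[of u] by (intro closure_of_minimal UN_least) (auto simp: Lower_iff)
  ultimately show ?thesis
    unfolding greatest_def using A F sub by (auto simp: Lower_iff le_iff)
qed

lemma complete_lattice: "complete_lattice L"
proof -
  interpret partial_order L by (rule partial_order)
  show ?thesis
    by unfold_locales (use least_Upper greatest_Lower in blast)+
qed

sublocale complete_lattice L by (rule complete_lattice)

lemma r_sup: "A \<subseteq> carrier L \<Longrightarrow> r (\<Squnion>A) = X closure_of \<Union>(r ` A)"
  using least_Upper[of A] sup_lub[of A] least_unique r_code[OF closure_Union_regular[of A]] by metis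

lemma r_join:
  assumes "a \<in> carrier L" "b \<in> carrier L" shows "r (a \<squnion> b) = r a \<union> r b"
  unfolding join_def using assms r_closedin by (simp add: r_sup closure_of_closedin)

lemma r_meet:
  assumes a: "a \<in> carrier L" and b: "b \<in> carrier L" shows "r (a \<sqinter> b) = regular_meet X (r a) (r b)"
proof
  let ?m = "code (regular_meet X (r a) (r b))"
  have m: "?m \<in> carrier L" "r ?m = regular_meet X (r a) (r b)" by (simp_all add: code_closed r_code)
  show "r (a \<sqinter> b) \<subseteq> regular_meet X (r a) (r b)"
    using a b meet_left[of a b] meet_right[of a b] by (simp add: subset_regular_meet_iff regular le_iff)
  have "?m \<sqsubseteq> a" "?m \<sqsubseteq> b"
    using subset_regular_meet_iff[of "r a" X "r b" "r ?m"] a b m by (simp_all add: regular le_iff)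
  then have "?m \<sqsubseteq> a \<sqinter> b" using a b m by (simp add: meet_le)
  then show "regular_meet X (r a) (r b) \<subseteq> r (a \<sqinter> b)" using a b m by (simp add: le_iff)
qed

lemma r_bottom: "r \<bottom> = {}"
  using bottom_lower[OF code_closed[OF empty_regular_closed]]
  by (simp add: le_iff code_closed empty_regular_closed r_code)

lemma r_top: "r \<top> = topspace X"
  using top_higher[OF code_closed[OF topspace_regular_closed]] regular_closedD(3)[OF regular[OF top_closed]]
  by (simp add: le_iff code_closed topspace_regular_closed r_code subset_antisym)

lemma eq_bottom_iff: "a \<in> carrier L \<Longrightarrow> a = \<bottom> \<longleftrightarrow> r a = {}"
  using r_bottom r_eq_iff[of a \<bottom>] by auto

lemma code_complement:
  assumes a: "a \<in> carrier L"
  defines "c \<equiv> code (topspace X - X interior_of r a)"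
  shows "c \<in> carrier L" "r c = topspace X - X interior_of r a" "a \<sqinter> c = \<bottom>" "a \<squnion> c = \<top>"
proof -
  show c: "c \<in> carrier L" "r c = topspace X - X interior_of r a"
    unfolding c_def using complement_regular_closed[OF regular[OF a]] by (simp_all add: code_closed r_code)
  have "r (a \<sqinter> c) = r \<bottom>" using a c by (simp add: r_meet r_bottom regular_meet_complement regular)
  then show "a \<sqinter> c = \<bottom>" using a c by (simp add: r_eq_iff)
  have "r (a \<squnion> c) = r \<top>"
    using a c interior_of_subset[of X "r a"] regular_closedD(3)[OF regular[OF a]] by (auto simp: r_join r_top)
  then show "a \<squnion> c = \<top>" using a c by (simp add: r_eq_iff)
qed

lemma boolean_lattice: "boolean_lattice L"
proof unfold_locales
  fix a b c assume "a \<in> carrier L" "b \<in> carrier L" "c \<in> carrier L"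
  then have "r (a \<sqinter> (b \<squnion> c)) = r ((a \<sqinter> b) \<squnion> (a \<sqinter> c))" "a \<sqinter> (b \<squnion> c) \<in> carrier L" "(a \<sqinter> b) \<squnion> (a \<sqinter> c) \<in> carrier L"
    by (simp_all add: r_join r_meet regular_meet_Un_distrib regular)
  then show "a \<sqinter> (b \<squnion> c) = (a \<sqinter> b) \<squnion> (a \<sqinter> c)" by (simp add: r_eq_iff)
next
  fix a assume "a \<in> carrier L"
  from code_complement[OF this] show "\<exists>b \<in> carrier L. a \<sqinter> b = \<bottom> \<and> a \<squnion> b = \<top>"
    by (intro bexI conjI)
qed

sublocale boolean_lattice L by (rule boolean_lattice)

lemma r_compl: "a \<in> carrier L \<Longrightarrow> r (compl a) = topspace X - X interior_of r a"
  using complement_eqI code_complement by metis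

lemma non_tangential_iff:
  assumes "a \<in> carrier L" "b \<in> carrier L"
  shows "a \<lless> b \<longleftrightarrow> r a \<subseteq> X interior_of (r b)"
  unfolding non_tangential_def contact_eq
  using assms regular_closedD(3)[OF regular[OF assms(1)]] by (auto simp: r_compl)

lemma contact_algebra: "contact_algebra L"
  by unfold_locales (auto simp: contact_eq eq_bottom_iff r_bottom r_join)

text \<open>
The interior of a regular closed set is dense in it.
\<close>

lemma interior_meets:
  assumes F: "F \<in> regular_closed X" and U: "openin X U" "U \<inter> F \<noteq> {}"
  shows "U \<inter> X interior_of F \<noteq> {}"
  using openin_Int_closure_of_eq_empty[OF U(1), of "X interior_of F"] regular_closedD(1)[OF F] U(2) by simp

text \<open>
As \<open>a \<lless> b\<close> means that \<open>r a\<close> lies in the interior of \<open>r b\<close>, all three axioms on bounded elements express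
the existence of compact regular closed neighbourhoods, of compact sets or of points.
\<close>

lemma complete_local_contact_algebra: "complete_local_contact_algebra L"
proof -
  interpret contact_algebra L by (rule contact_algebra)
  note nbhd = regular_closed_nbhd[OF locally_compact Hausdorff]
  note nbhd1 = regular_closed_point_nbhd[OF locally_compact Hausdorff]
  show ?thesis
  proof unfold_locales
    show "lattice_ideal L (bdd L)"
      unfolding lattice_ideal_def
    proof (intro conjI ballI impI)
      fix a b assume a: "a \<in> bdd L"
      { assume b: "b \<in> carrier L" "b \<sqsubseteq> a"
        have "compactin X (r b)"
          by (rule closed_compactin[of X "r a"]) (use a b in \<open>auto simp: bdd_eq le_iff r_closedin\<close>)
        then show "b \<in> bdd L" using b by (simp add: bdd_eq) }
      assume "b \<in> bdd L"
      then show "a \<squnion> b \<in> bdd L" using a by (auto simp: bdd_eq r_join intro: compactin_Un)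
    qed (auto simp: bdd_eq r_bottom)
  next
    fix a c assume a: "a \<in> bdd L" and c: "c \<in> carrier L" and ac: "a \<lless> c"
    have a': "a \<in> carrier L" "compactin X (r a)" using a by (auto simp: bdd_eq)
    obtain F where F: "F \<in> regular_closed X" "compactin X F" "r a \<subseteq> X interior_of F" "F \<subseteq> X interior_of (r c)"
      using nbhd[OF a'(2), of "X interior_of (r c)"] ac a' c by (auto simp: non_tangential_iff)
    then show "\<exists>b \<in> bdd L. a \<lless> b \<and> b \<lless> c"
      using a' c by (intro bexI[of _ "code F"]) (auto simp: bdd_eq non_tangential_iff code_closed r_code)
  next
    fix a b assume "(a, b) \<in> contact L"
    then obtain x where ab: "a \<in> carrier L" "b \<in> carrier L" and x: "x \<in> r a" "x \<in> r b" by (auto simp: contact_eq)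
    have "x \<in> topspace X" using x(1) regular_closedD(3)[OF regular[OF ab(1)]] by (rule rev_subsetD)
    then obtain F where F: "F \<in> regular_closed X" "compactin X F" "x \<in> X interior_of F" "F \<subseteq> topspace X"
      by (rule nbhd1[OF openin_topspace])
    have "x \<in> X interior_of F \<inter> X closure_of (X interior_of (r b))"
      using x F ab regular_closedD(1)[OF regular] by simp
    then have "x \<in> regular_meet X F (r b)"
      unfolding regular_meet_def using openin_Int_closure_of_subset[of X "X interior_of F"] by auto
    then show "\<exists>c \<in> bdd L. (a, c \<sqinter> b) \<in> contact L"
      using F ab x by (intro bexI[of _ "code F"]) (auto simp: bdd_eq contact_eq code_closed r_code r_meet)
  next
    fix a assume a: "a \<in> carrier L" "a \<noteq> \<bottom>"
    then obtain x where "x \<in> X interior_of (r a)"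
      using regular_closed_empty_iff[OF regular[OF a(1)]] by (auto simp: eq_bottom_iff)
    then obtain F where F: "F \<in> regular_closed X" "compactin X F" "x \<in> X interior_of F" "F \<subseteq> X interior_of (r a)"
      using nbhd1[of "X interior_of (r a)" x] by auto
    then show "\<exists>b \<in> bdd L. b \<noteq> \<bottom> \<and> b \<lless> a"
      using a interior_of_subset[of X F]
      by (intro bexI[of _ "code F"]) (auto simp: bdd_eq non_tangential_iff eq_bottom_iff code_closed r_code)
  qed
qed

sublocale complete_local_contact_algebra L by (rule complete_local_contact_algebra)

end

section \<open>Right adjoints and composition of algebra morphisms\<close>

text \<open>
The right adjoint at \<open>b\<close> is the join of all \<open>a\<close> with \<open>\<psi> a \<sqsubseteq> b\<close>.
\<close>

lemma right_adjoint:
  assumes \<psi>: "\<psi> \<in> carrier A \<rightarrow> carrier B" "sup_pres A B \<psi>" and b: "b \<in> carrier B"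
  shows right_adjoint_closed: "right_adjoint A B \<psi> b \<in> carrier A"
    and le_right_adjoint_iff: "a \<in> carrier A \<Longrightarrow> a \<sqsubseteq>\<^bsub>A\<^esub> right_adjoint A B \<psi> b \<longleftrightarrow> \<psi> a \<sqsubseteq>\<^bsub>B\<^esub> b"
proof -
  interpret A: complete_lattice A using \<psi>(2) by (simp add: sup_pres_def)
  interpret B: complete_lattice B using \<psi>(2) by (simp add: sup_pres_def)
  have iso: "isotone A B \<psi>"
    using \<psi> by (intro join_pres_isotone sup_pres_is_join_pres weak_sup_pres)
  define S where "S = {a \<in> carrier A. \<psi> a \<sqsubseteq>\<^bsub>B\<^esub> b}"
  have S: "S \<subseteq> carrier A" unfolding S_def by blast
  define p where "p = \<Squnion>\<^bsub>A\<^esub>S"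
  have p: "p \<in> carrier A" unfolding p_def using S by simp
  have "\<psi> p = \<Squnion>\<^bsub>B\<^esub>(\<psi> ` S)" unfolding p_def using \<psi>(2) S by (simp add: sup_pres_def)
  also have "\<dots> \<sqsubseteq>\<^bsub>B\<^esub> b"
    by (rule B.sup_least) (use S \<psi> b in \<open>auto simp: S_def\<close>)
  finally have "\<psi> p \<sqsubseteq>\<^bsub>B\<^esub> b" .
  then have adj: "\<psi> a \<sqsubseteq>\<^bsub>B\<^esub> b \<longleftrightarrow> a \<sqsubseteq>\<^bsub>A\<^esub> p" if "a \<in> carrier A" for a
  proof (intro iffI)
    assume "\<psi> a \<sqsubseteq>\<^bsub>B\<^esub> b"
    then show "a \<sqsubseteq>\<^bsub>A\<^esub> p" unfolding p_def using S that by (intro A.sup_upper) (auto simp: S_def)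
  next
    assume "\<psi> p \<sqsubseteq>\<^bsub>B\<^esub> b" "a \<sqsubseteq>\<^bsub>A\<^esub> p"
    then show "\<psi> a \<sqsubseteq>\<^bsub>B\<^esub> b"
      using use_iso2[OF iso that p] B.le_trans[of "\<psi> a" "\<psi> p" b] \<psi>(1) p that b by auto
  qed
  have "right_adjoint A B \<psi> b = p"
    unfolding right_adjoint_def
  proof (rule the_equality)
    fix q assume q: "q \<in> carrier A \<and> (\<forall>a \<in> carrier A. \<psi> a \<sqsubseteq>\<^bsub>B\<^esub> b \<longleftrightarrow> a \<sqsubseteq>\<^bsub>A\<^esub> q)"
    then show "q = p" using adj p by (intro A.le_antisym) auto
  qed (use adj p in auto)
  then show "right_adjoint A B \<psi> b \<in> carrier A"
    and "a \<in> carrier A \<Longrightarrow> a \<sqsubseteq>\<^bsub>A\<^esub> right_adjoint A B \<psi> b \<longleftrightarrow> \<psi> a \<sqsubseteq>\<^bsub>B\<^esub> b"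
    using p adj by auto
qed

lemma right_adjoint_eqI:
  assumes "partial_order A" "p \<in> carrier A" "\<And>a. a \<in> carrier A \<Longrightarrow> \<psi> a \<sqsubseteq>\<^bsub>B\<^esub> b \<longleftrightarrow> a \<sqsubseteq>\<^bsub>A\<^esub> p"
  shows "right_adjoint A B \<psi> b = p"
  unfolding right_adjoint_def
proof (rule the_equality)
  interpret partial_order A by fact
  fix q assume q: "q \<in> carrier A \<and> (\<forall>a \<in> carrier A. \<psi> a \<sqsubseteq>\<^bsub>B\<^esub> b \<longleftrightarrow> a \<sqsubseteq>\<^bsub>A\<^esub> q)"
  then have "p \<sqsubseteq>\<^bsub>A\<^esub> q" "q \<sqsubseteq>\<^bsub>A\<^esub> p" using assms(2) assms(3)[of p] assms(3)[of q] by auto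
  then show "q = p" using assms(2) q by (intro le_antisym) auto
qed (use assms in auto)

lemma ESkePerLC_homD:
  assumes "\<psi> \<in> ESkePerLC_hom A B"
  shows "\<psi> \<in> carrier A \<rightarrow>\<^sub>E carrier B"
    and "\<And>a. a \<in> carrier A \<Longrightarrow> \<psi> a = \<bottom>\<^bsub>B\<^esub> \<longleftrightarrow> a = \<bottom>\<^bsub>A\<^esub>"
    and "sup_pres A B \<psi>"
    and "\<And>a b. \<lbrakk>a \<in> carrier A; b \<in> carrier B; b \<sqsubseteq>\<^bsub>B\<^esub> \<psi> a\<rbrakk> \<Longrightarrow> \<exists>c \<in> carrier A. c \<sqsubseteq>\<^bsub>A\<^esub> a \<and> \<psi> c = b"
    and "\<And>a b. \<lbrakk>a \<in> carrier A; b \<in> carrier A; (a, b) \<in> contact A\<rbrakk> \<Longrightarrow> (\<psi> a, \<psi> b) \<in> contact B"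
    and "\<And>a. a \<in> bdd A \<Longrightarrow> \<psi> a \<in> bdd B"
    and "\<And>b. b \<in> bdd B \<Longrightarrow> right_adjoint A B \<psi> b \<in> bdd A"
  using assms unfolding ESkePerLC_hom_def by auto

lemma ESkePerLC_hom_ident:
  assumes A: "complete_local_contact_algebra A"
  shows "(\<lambda>a \<in> carrier A. a) \<in> ESkePerLC_hom A A"
proof -
  interpret complete_local_contact_algebra A by fact
  have "right_adjoint A A (\<lambda>a \<in> carrier A. a) b = b" if "b \<in> bdd A" for b
    using that bdd_closed by (intro right_adjoint_eqI) (auto intro: partial_order_axioms)
  moreover have "sup_pres A A (\<lambda>a \<in> carrier A. a)"
    unfolding sup_pres_def by (auto intro: complete_lattice_axioms simp: Int_absorb2 Int_absorb1 subset_eq intro!: arg_cong[of _ _ "Lattice.sup A"])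
  ultimately show ?thesis
    unfolding ESkePerLC_hom_def using bdd_closed by (auto simp: restrict_def)
qed

text \<open>
Boundedness of the right adjoint is inherited because the right adjoint of a composite is the composite
of the right adjoints in reverse order.
\<close>

lemma ESkePerLC_hom_compose:
  assumes \<phi>: "\<phi> \<in> ESkePerLC_hom A B" and \<theta>: "\<theta> \<in> ESkePerLC_hom B D"
    and A: "bdd A \<subseteq> carrier A" and D: "bdd D \<subseteq> carrier D"
  shows "compose (carrier A) \<theta> \<phi> \<in> ESkePerLC_hom A D"
proof -
  note P = ESkePerLC_homD[OF \<phi>] and C = ESkePerLC_homD[OF \<theta>]
  have PA: "\<phi> \<in> carrier A \<rightarrow> carrier B" and CB: "\<theta> \<in> carrier B \<rightarrow> carrier D"
    using P(1) C(1) by auto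
  interpret A: complete_lattice A using P(3) by (simp add: sup_pres_def)
  have "sup_pres A D (compose (carrier A) \<theta> \<phi>)"
    unfolding sup_pres_def
  proof (intro conjI allI impI)
    fix S assume S: "S \<subseteq> carrier A"
    have "\<phi> ` S \<subseteq> carrier B" using S PA by auto
    moreover have "compose (carrier A) \<theta> \<phi> ` S = \<theta> ` \<phi> ` S"
      using S by (force simp: compose_def)
    moreover have "\<Squnion>\<^bsub>A\<^esub>S \<in> carrier A" using S by simp
    ultimately show "compose (carrier A) \<theta> \<phi> (\<Squnion>\<^bsub>A\<^esub>S) = \<Squnion>\<^bsub>D\<^esub>(compose (carrier A) \<theta> \<phi> ` S)"
      using P(3) C(3) S by (simp add: sup_pres_def compose_def)
  qed (use P(3) C(3) in \<open>auto simp: sup_pres_def\<close>)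
  moreover have "right_adjoint A D (compose (carrier A) \<theta> \<phi>) d \<in> bdd A" if d: "d \<in> bdd D" for d
  proof -
    have dc: "d \<in> carrier D" using d D by blast
    let ?b = "right_adjoint B D \<theta> d"
    have b: "?b \<in> carrier B" by (rule right_adjoint_closed[OF CB C(3) dc])
    have "right_adjoint A D (compose (carrier A) \<theta> \<phi>) d = right_adjoint A B \<phi> ?b"
    proof (rule right_adjoint_eqI)
      show "right_adjoint A B \<phi> ?b \<in> carrier A" by (rule right_adjoint_closed[OF PA P(3) b])
      fix a assume a: "a \<in> carrier A"
      then have "\<phi> a \<in> carrier B" using PA by auto
      then show "compose (carrier A) \<theta> \<phi> a \<sqsubseteq>\<^bsub>D\<^esub> d \<longleftrightarrow> a \<sqsubseteq>\<^bsub>A\<^esub> right_adjoint A B \<phi> ?b"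
        using a le_right_adjoint_iff[OF PA P(3) b a] le_right_adjoint_iff[OF CB C(3) dc, of "\<phi> a"]
        by (simp add: compose_def)
    qed (rule A.partial_order_axioms)
    then show ?thesis using P(7) C(7) d by simp
  qed
  moreover have "\<exists>c \<in> carrier A. c \<sqsubseteq>\<^bsub>A\<^esub> a \<and> compose (carrier A) \<theta> \<phi> c = d"
    if a: "a \<in> carrier A" and d: "d \<in> carrier D" and le: "d \<sqsubseteq>\<^bsub>D\<^esub> compose (carrier A) \<theta> \<phi> a" for a d
  proof -
    have pa: "\<phi> a \<in> carrier B" using PA a by auto
    obtain b where b: "b \<in> carrier B" "b \<sqsubseteq>\<^bsub>B\<^esub> \<phi> a" "\<theta> b = d"
      using C(4)[OF pa d] le a by (auto simp: compose_def)
    obtain c where c: "c \<in> carrier A" "c \<sqsubseteq>\<^bsub>A\<^esub> a" "\<phi> c = b"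
      using P(4)[OF a b(1,2)] by auto
    then show ?thesis using b by (intro bexI[of _ c]) (auto simp: compose_def)
  qed
  moreover have "compose (carrier A) \<theta> \<phi> a \<in> bdd D" if "a \<in> bdd A" for a
    using that A P(6) C(6) by (auto simp: compose_def)
  moreover have "compose (carrier A) \<theta> \<phi> a = \<bottom>\<^bsub>D\<^esub> \<longleftrightarrow> a = \<bottom>\<^bsub>A\<^esub>" if "a \<in> carrier A" for a
    using that P(2)[OF that] C(2)[OF funcset_mem[OF PA that]] by (simp add: compose_def)
  moreover have "(compose (carrier A) \<theta> \<phi> a, compose (carrier A) \<theta> \<phi> b) \<in> contact D"
    if "a \<in> carrier A" "b \<in> carrier A" "(a, b) \<in> contact A" for a b
    using that P(5)[OF that] C(5)[OF funcset_mem[OF PA that(1)] funcset_mem[OF PA that(2)]] by (simp add: compose_def)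
  ultimately show ?thesis
    unfolding ESkePerLC_hom_def using PA CB by (auto simp: compose_def)
qed

section \<open>Skeletal perfect maps and regular closed sets\<close>

text \<open>
The arrows of the category of spaces, for spaces over arbitrary types.
\<close>

definition skeletal_perfect :: "'x topology \<Rightarrow> 'y topology \<Rightarrow> ('x \<Rightarrow> 'y) \<Rightarrow> bool" where
  "skeletal_perfect X Y f \<longleftrightarrow> f \<in> topspace X \<rightarrow>\<^sub>E topspace Y \<and>
     continuous_map X Y f \<and> proper_map X Y f \<and> skeletal_map X Y f"

text \<open>
Let \<open>W\<close> be the interior of \<open>f ` F\<close> and \<open>V\<close> the complement of \<open>f ` F\<close>, so that the closure of \<open>V\<close> is the complement of
\<open>W\<close>.  The part of the interior of \<open>F\<close> that \<open>f\<close> maps outside the closure of \<open>W\<close> is an open subset of the preimage of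
the closure of \<open>V\<close>.  As \<open>f\<close> is skeletal, it lies in the closure of the preimage of \<open>V\<close>, which it does not meet; so it is
empty.
\<close>

lemma skeletal_image_regular_closed:
  assumes cont: "continuous_map X Y f" and cl: "closed_map X Y f" and sk: "skeletal_map X Y f"
    and F: "F \<in> regular_closed X"
  shows "f ` F \<in> regular_closed Y"
proof -
  note FX = regular_closedD[OF F]
  have K: "closedin Y (f ` F)" using cl FX(2) by (simp add: closed_map_def)
  let ?W = "Y interior_of (f ` F)" and ?V = "topspace Y - f ` F"
  have V: "openin Y ?V" using K by (simp add: openin_diff)
  have clV: "Y closure_of ?V = topspace Y - ?W" by (simp add: closure_of_complement)
  define U where "U = X interior_of F \<inter> {x \<in> topspace X. f x \<in> topspace Y - Y closure_of ?W}"
  have U: "openin X U" unfolding U_def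
    using cont by (intro openin_Int openin_interior_of openin_continuous_map_preimage) (auto simp: openin_diff)
  have "?W \<subseteq> Y closure_of ?W" by (simp add: closure_of_subset interior_of_subset_topspace)
  then have "U \<subseteq> {x \<in> topspace X. f x \<in> Y closure_of ?V}"
    unfolding clV U_def by blast
  then have "U \<subseteq> X interior_of {x \<in> topspace X. f x \<in> Y closure_of ?V}"
    using U by (rule interior_of_maximal)
  also have "\<dots> \<subseteq> X closure_of {x \<in> topspace X. f x \<in> ?V}"
    using sk V unfolding skeletal_map_def by blast
  finally have "U \<inter> X closure_of {x \<in> topspace X. f x \<in> ?V} = U" by blast
  moreover have "U \<inter> {x \<in> topspace X. f x \<in> ?V} = {}"
    unfolding U_def using interior_of_subset[of X F] by blast
  ultimately have "U = {}"
    using openin_Int_closure_of_eq_empty[OF U, of "{x \<in> topspace X. f x \<in> ?V}"] by blast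
  then have "X interior_of F \<subseteq> {x \<in> topspace X. f x \<in> Y closure_of ?W}"
    unfolding U_def using interior_of_subset_topspace[of X F] continuous_map_image_subset_topspace[OF cont] by blast
  then have "X closure_of (X interior_of F) \<subseteq> {x \<in> topspace X. f x \<in> Y closure_of ?W}"
    using cont by (intro closure_of_minimal closedin_continuous_map_preimage) auto
  then have "f ` F \<subseteq> Y closure_of ?W" unfolding FX(1) by blast
  moreover have "Y closure_of ?W \<subseteq> f ` F" using K by (simp add: closure_of_minimal interior_of_subset)
  ultimately show ?thesis unfolding regular_closed_def by blast
qed

text \<open>
If \<open>f\<close> were not skeletal at \<open>V\<close>, a nonempty regular closed \<open>F\<close> would lie in the preimage of the closure of \<open>V\<close> and miss
the preimage of \<open>V\<close>.  But \<open>f ` F\<close> has nonempty interior inside the closure of \<open>V\<close>, so it meets \<open>V\<close>.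
Through this criterion composites and duals of morphisms are seen to be skeletal.
\<close>

lemma skeletal_mapI_image_regular_closed:
  assumes X: "locally_compact_space X" "Hausdorff_space X"
    and im: "\<And>F. F \<in> regular_closed X \<Longrightarrow> f ` F \<in> regular_closed Y"
  shows "skeletal_map X Y f"
  unfolding skeletal_map_def
proof (intro allI impI)
  fix V assume V: "openin Y V"
  let ?P = "\<lambda>S. {x \<in> topspace X. f x \<in> S}"
  show "X interior_of (?P (Y closure_of V)) \<subseteq> X closure_of (?P V)"
  proof (rule ccontr)
    assume "\<not> ?thesis"
    then obtain x where x: "x \<in> X interior_of (?P (Y closure_of V)) - X closure_of (?P V)" by blast
    have op: "openin X (X interior_of (?P (Y closure_of V)) - X closure_of (?P V))"
      by (intro openin_diff) auto
    obtain F where F: "F \<in> regular_closed X" "compactin X F" "x \<in> X interior_of F"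
        "F \<subseteq> X interior_of (?P (Y closure_of V)) - X closure_of (?P V)"
      by (rule regular_closed_point_nbhd[OF X op x])
    have "f ` F \<noteq> {}" using F(3) interior_of_subset[of X F] by blast
    then have "Y interior_of (f ` F) \<noteq> {}"
      using regular_closed_empty_iff[OF im[OF F(1)]] by simp
    moreover have "Y interior_of (f ` F) \<subseteq> Y closure_of V"
      using F(4) interior_of_subset[of X "?P (Y closure_of V)"] interior_of_subset[of Y "f ` F"] by blast
    ultimately have "Y interior_of (f ` F) \<inter> V \<noteq> {}"
      using openin_Int_closure_of_eq_empty[of Y "Y interior_of (f ` F)" V] by (simp add: Int_absorb2)
    then obtain z where z: "z \<in> F" "f z \<in> V" using interior_of_subset[of Y "f ` F"] by blast
    then have "z \<in> ?P V" using regular_closedD(3)[OF F(1)] by blast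
    then have "z \<in> X closure_of (?P V)" using closure_of_subset[of "?P V" X] by blast
    then show False using F(4) z(1) by blast
  qed
qed

lemma skeletal_perfectD:
  assumes "skeletal_perfect X Y f"
  shows "f \<in> topspace X \<rightarrow>\<^sub>E topspace Y" "continuous_map X Y f" "proper_map X Y f" "closed_map X Y f"
    and "\<And>F. F \<in> regular_closed X \<Longrightarrow> f ` F \<in> regular_closed Y"
  using assms skeletal_image_regular_closed[of X Y f] unfolding skeletal_perfect_def by (auto simp: proper_imp_closed_map)

text \<open>
Morphisms are extensional, whereas identities and composites first arise as total functions.
\<close>

lemma skeletal_perfect_restrictI:
  assumes X: "locally_compact_space X" "Hausdorff_space X"
    and cont: "continuous_map X Y f" and prp: "proper_map X Y f"
    and im: "\<And>F. F \<in> regular_closed X \<Longrightarrow> f ` F \<in> regular_closed Y"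
  shows "skeletal_perfect X Y (restrict f (topspace X))"
proof -
  have "continuous_map X Y (restrict f (topspace X))" by (rule continuous_map_eq[OF cont]) simp
  moreover have "closed_map X Y (restrict f (topspace X))"
    by (rule closed_map_eq[OF proper_imp_closed_map[OF prp]]) simp
  moreover have "{x \<in> topspace X. restrict f (topspace X) x = y} = {x \<in> topspace X. f x = y}" for y by auto
  moreover have "skeletal_map X Y (restrict f (topspace X))"
  proof (rule skeletal_mapI_image_regular_closed[OF X])
    fix F assume F: "F \<in> regular_closed X"
    then have "restrict f (topspace X) ` F = f ` F" using regular_closedD(3) by (intro image_cong) auto
    then show "restrict f (topspace X) ` F \<in> regular_closed Y" using im F by simp
  qed
  moreover have "restrict f (topspace X) \<in> topspace X \<rightarrow>\<^sub>E topspace Y"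
    using continuous_map_image_subset_topspace[OF cont] by auto
  ultimately show ?thesis using prp unfolding skeletal_perfect_def proper_map_def by simp
qed

lemma skeletal_perfect_ident:
  assumes "locally_compact_space X" "Hausdorff_space X"
  shows "skeletal_perfect X X (\<lambda>x \<in> topspace X. x)"
  using skeletal_perfect_restrictI[OF assms, of X id] by (simp add: id_def[symmetric])

lemma skeletal_perfect_compose:
  assumes X: "locally_compact_space X" "Hausdorff_space X"
    and f: "skeletal_perfect X Y f" and g: "skeletal_perfect Y Z g"
  shows "skeletal_perfect X Z (compose (topspace X) g f)"
proof -
  note f = skeletal_perfectD[OF f] and g = skeletal_perfectD[OF g]
  have "skeletal_perfect X Z (restrict (g \<circ> f) (topspace X))"
  proof (rule skeletal_perfect_restrictI[OF X])
    show "(g \<circ> f) ` F \<in> regular_closed Z" if "F \<in> regular_closed X" for F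
      unfolding image_comp[symmetric] using that by (intro g(5) f(5))
  qed (use f g in \<open>auto intro: continuous_map_compose proper_map_compose\<close>)
  then show ?thesis by (simp add: compose_def restrict_def o_def)
qed

section \<open>The algebra morphism induced by a skeletal perfect map\<close>

locale rc_pair = X: rc_representation X L r + Y: rc_representation Y M s
  for X :: "'x topology" and L :: "'a local_contact_structure" and r :: "'a \<Rightarrow> 'x set"
    and Y :: "'y topology" and M :: "'b local_contact_structure" and s :: "'b \<Rightarrow> 'y set"
begin

definition induced :: "('x \<Rightarrow> 'y) \<Rightarrow> 'a \<Rightarrow> 'b" where
  "induced f = (\<lambda>a \<in> carrier L. Y.code (f ` r a))"

lemma s_induced:
  assumes "skeletal_perfect X Y f" "a \<in> carrier L"
  shows "induced f a \<in> carrier M" "s (induced f a) = f ` r a"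
  using skeletal_perfectD(5)[OF assms(1) X.regular[OF assms(2)]] assms(2)
  by (simp_all add: induced_def Y.code_closed Y.r_code)

text \<open>
Every identity between induced morphisms is checked on the represented sets.
\<close>

lemma induced_eqI:
  assumes "\<psi> \<in> extensional (carrier L)" "\<And>a. a \<in> carrier L \<Longrightarrow> \<psi> a \<in> carrier M \<and> s (\<psi> a) = f ` r a"
  shows "induced f = \<psi>"
proof
  show "induced f a = \<psi> a" for a
    using assms Y.code_r[of "\<psi> a"] by (cases "a \<in> carrier L") (auto simp: induced_def extensional_def)
qed

lemma sup_pres_induced:
  assumes f: "skeletal_perfect X Y f"
  shows "sup_pres L M (induced f)"
  unfolding sup_pres_def
proof (intro conjI allI impI X.complete_lattice Y.complete_lattice)
  note f' = skeletal_perfectD[OF f]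
  fix A assume A: "A \<subseteq> carrier L"
  have top: "\<Union>(r ` A) \<subseteq> topspace X" using A X.regular regular_closedD(3) by blast
  have clo: "f ` (X closure_of S) = Y closure_of (f ` S)" if "S \<subseteq> topspace X" for S
    using that f'(4) continuous_map_image_closure_subset[OF f'(2)]
    unfolding closed_map_closure_of_image by (intro equalityI) auto
  have A': "induced f ` A \<subseteq> carrier M" using A s_induced(1)[OF f] by blast
  have "s (induced f (\<Squnion>\<^bsub>L\<^esub>A)) = f ` (X closure_of \<Union>(r ` A))"
    using A s_induced(2)[OF f X.sup_closed[OF A]] by (simp add: X.r_sup)
  also have "\<dots> = Y closure_of (\<Union>a \<in> A. f ` r a)"
    using clo[OF top] by (simp add: image_UN)
  also have "(\<Union>a \<in> A. f ` r a) = \<Union>(s ` (induced f ` A))"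
    using A s_induced(2)[OF f] by (auto simp: subset_eq)
  also have "Y closure_of \<dots> = s (\<Squnion>\<^bsub>M\<^esub>(induced f ` A))"
    using A' by (simp add: Y.r_sup)
  finally show "induced f (\<Squnion>\<^bsub>L\<^esub>A) = \<Squnion>\<^bsub>M\<^esub>(induced f ` A)"
    using A A' s_induced(1)[OF f] by (simp add: Y.r_eq_iff)
qed

text \<open>
For the lifting condition, \<open>b\<close> is the image of the closure of the part of the interior of \<open>r a\<close> that \<open>f\<close> maps into
the interior of \<open>s b\<close>.  Its image is closed and contains a dense part of \<open>s b\<close>, since the image of the interior
of \<open>r a\<close> is dense in \<open>f ` r a\<close>.  The right adjoint preserves boundedness because the set it assigns to \<open>b\<close>
is a closed subset of the preimage of \<open>s b\<close>, which is compact as \<open>f\<close> is proper.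
\<close>

lemma induced_hom:
  assumes f: "skeletal_perfect X Y f"
  shows "induced f \<in> ESkePerLC_hom L M"
proof -
  note f' = skeletal_perfectD[OF f] and i = s_induced[OF f]
  have ext: "induced f \<in> carrier L \<rightarrow>\<^sub>E carrier M" using i(1) by (auto simp: induced_def)
  have fn: "induced f \<in> carrier L \<rightarrow> carrier M" using i(1) by blast
  have "\<exists>c \<in> carrier L. c \<sqsubseteq>\<^bsub>L\<^esub> a \<and> induced f c = b"
    if a: "a \<in> carrier L" and b: "b \<in> carrier M" and ba: "b \<sqsubseteq>\<^bsub>M\<^esub> induced f a" for a b
  proof -
    have sub: "s b \<subseteq> f ` r a" using ba a b i by (simp add: Y.le_iff)
    let ?P = "{x \<in> topspace X. f x \<in> Y interior_of (s b)}"
    let ?c = "X closure_of (X interior_of (r a) \<inter> ?P)"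
    have "openin X ?P" using f'(2) by (intro openin_continuous_map_preimage) auto
    then have c: "?c \<in> regular_closed X"
      by (intro closure_of_open_regular_closed openin_Int openin_interior_of)
    have ca: "?c \<subseteq> r a"
      using X.r_closedin[OF a] interior_of_subset[of X "r a"] by (intro closure_of_minimal) auto
    have "f ` ?c \<subseteq> s b"
    proof -
      have "?c \<subseteq> {x \<in> topspace X. f x \<in> s b}"
        using f'(2) Y.r_closedin[OF b] interior_of_subset[of Y "s b"]
        by (intro closure_of_minimal closedin_continuous_map_preimage) auto
      then show ?thesis by blast
    qed
    moreover have "s b \<subseteq> f ` ?c"
    proof -
      have fc: "closedin Y (f ` ?c)" using f'(4) by (simp add: closed_map_def)
      have ra: "X interior_of (r a) \<subseteq> topspace X" by (rule interior_of_subset_topspace)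
      have "f ` r a \<subseteq> Y closure_of (f ` (X interior_of (r a)))"
        using continuous_map_image_closure_subset[OF f'(2), of "X interior_of (r a)"]
          regular_closedD(1)[OF X.regular[OF a]] by simp
      then have "Y interior_of (s b) \<subseteq> Y interior_of (s b) \<inter> Y closure_of (f ` (X interior_of (r a)))"
        using sub interior_of_subset[of Y "s b"] by blast
      also have "\<dots> \<subseteq> Y closure_of (Y interior_of (s b) \<inter> f ` (X interior_of (r a)))"
        by (rule openin_Int_closure_of_subset) simp
      also have "Y interior_of (s b) \<inter> f ` (X interior_of (r a)) \<subseteq> f ` ?c"
      proof -
        have "X interior_of (r a) \<inter> ?P \<subseteq> ?c" using ra by (intro closure_of_subset) blast
        then show ?thesis using ra by blast
      qed
      then have "Y closure_of (Y interior_of (s b) \<inter> f ` (X interior_of (r a))) \<subseteq> f ` ?c"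
        using fc by (rule closure_of_minimal)
      finally have "Y closure_of (Y interior_of (s b)) \<subseteq> f ` ?c"
        using fc by (rule closure_of_minimal)
      then show ?thesis by (simp add: regular_closedD(1)[OF Y.regular[OF b]])
    qed
    ultimately have "f ` ?c = s b" by (rule equalityI)
    moreover have cc: "X.code ?c \<in> carrier L" "r (X.code ?c) = ?c" using c by (simp_all add: X.code_closed X.r_code)
    ultimately have "induced f (X.code ?c) = b"
      using i[OF cc(1)] b Y.r_eq_iff[of "induced f (X.code ?c)" b] by simp
    then show ?thesis using cc ca a by (intro bexI[of _ "X.code ?c"]) (auto simp: X.le_iff)
  qed
  moreover have "induced f a \<in> bdd M" if "a \<in> bdd L" for a
    using that i image_compactin[OF _ f'(2)] by (auto simp: X.bdd_eq Y.bdd_eq)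
  moreover have "right_adjoint L M (induced f) b \<in> bdd L" if "b \<in> bdd M" for b
  proof -
    have b: "b \<in> carrier M" "compactin Y (s b)" using that by (auto simp: Y.bdd_eq)
    note sp = sup_pres_induced[OF f]
    let ?q = "right_adjoint L M (induced f) b"
    have q: "?q \<in> carrier L" by (rule right_adjoint_closed[OF fn sp b(1)])
    have "induced f ?q \<sqsubseteq>\<^bsub>M\<^esub> b" using le_right_adjoint_iff[OF fn sp b(1) q] q by simp
    then have "f ` r ?q \<subseteq> s b" using i[OF q] b by (simp add: Y.le_iff)
    then have "r ?q \<subseteq> {x \<in> topspace X. f x \<in> s b}" using regular_closedD(3)[OF X.regular[OF q]] by blast
    moreover have "compactin X {x \<in> topspace X. f x \<in> s b}"
      using f'(3) b(2) by (rule compactin_proper_map_preimage)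
    ultimately have "compactin X (r ?q)" using X.r_closedin[OF q] closed_compactin by blast
    then show ?thesis using q by (simp add: X.bdd_eq)
  qed
  moreover have "induced f a = \<bottom>\<^bsub>M\<^esub> \<longleftrightarrow> a = \<bottom>\<^bsub>L\<^esub>" if "a \<in> carrier L" for a
    using i[OF that] that by (simp add: Y.eq_bottom_iff X.eq_bottom_iff)
  moreover have "(induced f a, induced f b) \<in> contact M"
    if "a \<in> carrier L" "b \<in> carrier L" "(a, b) \<in> contact L" for a b
    using i that by (auto simp: X.contact_eq Y.contact_eq)
  ultimately show ?thesis
    unfolding ESkePerLC_hom_def using ext sup_pres_induced[OF f] by auto
qed

text \<open>
If \<open>f x\<close> and \<open>g x\<close> had disjoint neighbourhoods, some regular closed neighbourhood of \<open>x\<close> would have disjoint images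
under \<open>f\<close> and \<open>g\<close>.
\<close>

lemma induced_inj:
  assumes f: "skeletal_perfect X Y f" and g: "skeletal_perfect X Y g" and eq: "induced f = induced g"
  shows "f = g"
proof
  note f' = skeletal_perfectD[OF f] and g' = skeletal_perfectD[OF g]
  fix x
  show "f x = g x"
  proof (cases "x \<in> topspace X")
    case True
    show ?thesis
    proof (rule ccontr)
      assume ne: "f x \<noteq> g x"
      have "f x \<in> topspace Y" "g x \<in> topspace Y" using f'(1) g'(1) True by auto
      then obtain V W where VW: "openin Y V" "openin Y W" "f x \<in> V" "g x \<in> W" "disjnt V W"
        using Y.Hausdorff ne unfolding Hausdorff_space_def by meson
      have "openin X ({x \<in> topspace X. f x \<in> V} \<inter> {x \<in> topspace X. g x \<in> W})"
        using f'(2) g'(2) VW by (intro openin_Int openin_continuous_map_preimage) auto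
      then obtain F where F: "F \<in> regular_closed X" "compactin X F" "x \<in> X interior_of F"
          "F \<subseteq> {x \<in> topspace X. f x \<in> V} \<inter> {x \<in> topspace X. g x \<in> W}"
        by (rule regular_closed_point_nbhd[OF X.locally_compact X.Hausdorff]) (use True VW in auto)
      have c: "X.code F \<in> carrier L" "r (X.code F) = F" using F by (simp_all add: X.code_closed X.r_code)
      have "f ` F = g ` F"
        using s_induced(2)[OF f c(1)] s_induced(2)[OF g c(1)] eq c by simp
      then have "f x \<in> g ` F" using F(3) interior_of_subset[of X F] by blast
      then show False using F(4) VW unfolding disjnt_def by (auto dest: subsetD)
    qed
  next
    case False
    then show ?thesis using f'(1) g'(1) by (metis PiE_arb)
  qed
qed

end

section \<open>Every algebra morphism is induced by a map\<close>

text \<open>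
The form in which compactness is used below: a downward directed family of compact sets whose
intersection lies in an open set has a member in that set.
\<close>

lemma directed_compact_Inter_subset:
  assumes X: "Hausdorff_space X" and ne: "\<K> \<noteq> {}" and comp: "\<And>K. K \<in> \<K> \<Longrightarrow> compactin X K"
    and dir: "\<And>K K'. \<lbrakk>K \<in> \<K>; K' \<in> \<K>\<rbrakk> \<Longrightarrow> \<exists>K'' \<in> \<K>. K'' \<subseteq> K \<inter> K'"
    and U: "openin X U" and sub: "\<Inter>\<K> \<subseteq> U"
  shows "\<exists>K \<in> \<K>. K \<subseteq> U"
proof (rule ccontr)
  assume no: "\<not> ?thesis"
  obtain K0 where K0: "K0 \<in> \<K>" using ne by blast
  let ?C = "(\<lambda>K. K - U) ` \<K>"
  have "\<forall>C \<in> ?C. closedin X C"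
    using comp X U by (auto intro: closedin_diff compactin_imp_closedin)
  moreover have "K0 \<inter> \<Inter>\<F> \<noteq> {}" if fin: "finite \<F>" and F: "\<F> \<subseteq> ?C" for \<F>
  proof -
    have "\<exists>K \<in> \<K>. K - U \<subseteq> K0 \<inter> \<Inter>\<F>"
      using fin F
    proof (induction \<F>)
      case empty then show ?case using K0 by blast
    next
      case (insert C \<F>)
      then obtain K K' where K: "K \<in> \<K>" "K - U \<subseteq> K0 \<inter> \<Inter>\<F>" and K': "K' \<in> \<K>" "C = K' - U" by auto
      obtain K'' where "K'' \<in> \<K>" "K'' \<subseteq> K \<inter> K'" using dir[OF K(1) K'(1)] by blast
      then show ?case using K K' by (intro bexI[of _ K'']) auto
    qed
    then obtain K where "K \<in> \<K>" "K - U \<subseteq> K0 \<inter> \<Inter>\<F>" ..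
    moreover have "K - U \<noteq> {}" using no \<open>K \<in> \<K>\<close> by (simp add: Diff_eq_empty_iff)
    ultimately show ?thesis by blast
  qed
  ultimately have "K0 \<inter> \<Inter>?C \<noteq> {}" using comp[OF K0] unfolding compactin_fip by blast
  then show False using sub K0 by blast
qed

corollary directed_compact_Inter_nonempty:
  assumes "Hausdorff_space X" "\<K> \<noteq> {}" "\<And>K. K \<in> \<K> \<Longrightarrow> compactin X K" "{} \<notin> \<K>"
    and "\<And>K K'. \<lbrakk>K \<in> \<K>; K' \<in> \<K>\<rbrakk> \<Longrightarrow> \<exists>K'' \<in> \<K>. K'' \<subseteq> K \<inter> K'"
  shows "\<Inter>\<K> \<noteq> {}"
  using directed_compact_Inter_subset[OF assms(1-3,5) openin_empty] assms(4) by auto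

context rc_representation
begin

text \<open>
The compact regular closed neighbourhoods of a point, as elements of the algebra.
\<close>

definition nbhds :: "'x \<Rightarrow> 'a set" where
  "nbhds x = {a \<in> bdd L. x \<in> X interior_of (r a)}"

lemma nbhdsD:
  assumes "a \<in> nbhds x"
  shows "a \<in> bdd L" "a \<in> carrier L" "x \<in> X interior_of (r a)" "x \<in> r a"
  using assms interior_of_subset[of X "r a"] bdd_closed[of a] unfolding nbhds_def by auto

lemma nbhds_meet:
  assumes a: "a \<in> nbhds x" and b: "b \<in> nbhds x"
  shows "a \<sqinter> b \<in> nbhds x"
proof -
  note a = nbhdsD[OF a] and b = nbhdsD[OF b]
  have op: "openin X (X interior_of (r a) \<inter> X interior_of (r b))" by auto
  have "X interior_of (r a) \<inter> X interior_of (r b) \<subseteq> r (a \<sqinter> b)"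
    using a b closure_of_subset[OF openin_subset[OF op]] by (simp add: r_meet regular_meet_def)
  then have "X interior_of (r a) \<inter> X interior_of (r b) \<subseteq> X interior_of (r (a \<sqinter> b))"
    using op by (rule interior_of_maximal)
  moreover have "a \<sqinter> b \<in> bdd L"
    using bdd_down[OF a(1), of "a \<sqinter> b"] a(2) b(2) meet_left[of a b] by simp
  ultimately show ?thesis using a b unfolding nbhds_def by blast
qed

lemma nbhds_within:
  assumes "openin X U" "x \<in> U"
  obtains a where "a \<in> nbhds x" "r a \<subseteq> U"
proof -
  obtain F where F: "F \<in> regular_closed X" "compactin X F" "x \<in> X interior_of F" "F \<subseteq> U"
    by (rule regular_closed_point_nbhd[OF locally_compact Hausdorff assms])
  then show ?thesis using that[of "code F"] by (simp add: nbhds_def bdd_eq code_closed r_code)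
qed

lemma nbhds_nonempty: "x \<in> topspace X \<Longrightarrow> nbhds x \<noteq> {}"
  using nbhds_within[OF openin_topspace] by (metis empty_iff)

lemma nbhds_separate:
  assumes "x \<in> topspace X" "y \<in> topspace X" "x \<noteq> y"
  obtains a b where "a \<in> nbhds x" "b \<in> nbhds y" "r a \<inter> r b = {}"
proof -
  obtain U V where "openin X U" "openin X V" "x \<in> U" "y \<in> V" "disjnt U V"
    using Hausdorff assms unfolding Hausdorff_space_def by meson
  then obtain a b where "a \<in> nbhds x" "r a \<subseteq> U" "b \<in> nbhds y" "r b \<subseteq> V"
    using nbhds_within by metis
  then show ?thesis using that \<open>disjnt U V\<close> unfolding disjnt_def by blast
qed

lemma compact_r: "a \<in> bdd L \<Longrightarrow> compactin X (r a)"
  by (simp add: bdd_eq)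

end

locale rc_morphism = rc_pair X L r Y M s
  for X :: "'x topology" and L :: "'a local_contact_structure" and r
    and Y :: "'y topology" and M :: "'b local_contact_structure" and s +
  fixes \<psi> :: "'a \<Rightarrow> 'b"
  assumes hom: "\<psi> \<in> ESkePerLC_hom L M"
begin

abbreviation adj :: "'b \<Rightarrow> 'a" where "adj \<equiv> right_adjoint L M \<psi>"

lemma psi_closed: "a \<in> carrier L \<Longrightarrow> \<psi> a \<in> carrier M"
  using ESkePerLC_homD(1)[OF hom] by auto

lemma psi_fun: "\<psi> \<in> carrier L \<rightarrow> carrier M"
  using psi_closed by blast

lemma adj_closed: "b \<in> carrier M \<Longrightarrow> adj b \<in> carrier L"
  by (rule right_adjoint_closed[OF psi_fun ESkePerLC_homD(3)[OF hom]])

lemma adj_iff: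
  assumes "a \<in> carrier L" "b \<in> carrier M"
  shows "r a \<subseteq> r (adj b) \<longleftrightarrow> s (\<psi> a) \<subseteq> s b"
  using le_right_adjoint_iff[OF psi_fun ESkePerLC_homD(3)[OF hom] assms(2,1)] assms
  by (simp add: X.le_iff Y.le_iff adj_closed psi_closed)

lemma psi_adj: "b \<in> carrier M \<Longrightarrow> s (\<psi> (adj b)) \<subseteq> s b"
  using adj_iff[OF adj_closed] by blast

lemma psi_mono:
  assumes "a \<in> carrier L" "b \<in> carrier L" "r a \<subseteq> r b" shows "s (\<psi> a) \<subseteq> s (\<psi> b)"
  using adj_iff[OF assms(1) psi_closed[OF assms(2)]] adj_iff[OF assms(2) psi_closed[OF assms(2)]] assms(3) by blast

lemma adj_mono:
  assumes "a \<in> carrier M" "b \<in> carrier M" "s a \<subseteq> s b" shows "r (adj a) \<subseteq> r (adj b)"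
  using adj_iff[OF adj_closed[OF assms(1)] assms(2)] psi_adj[OF assms(1)] assms(3) by blast

lemma psi_empty_iff: "a \<in> carrier L \<Longrightarrow> s (\<psi> a) = {} \<longleftrightarrow> r a = {}"
  using ESkePerLC_homD(2)[OF hom] X.eq_bottom_iff[of a] Y.eq_bottom_iff[OF psi_closed[of a]] by simp

lemma psi_meets:
  assumes "a \<in> carrier L" "b \<in> carrier L" "r a \<inter> r b \<noteq> {}"
  shows "s (\<psi> a) \<inter> s (\<psi> b) \<noteq> {}"
  using ESkePerLC_homD(5)[OF hom assms(1,2)] assms by (simp add: X.contact_eq Y.contact_eq)

lemma psi_bdd: "a \<in> bdd L \<Longrightarrow> \<psi> a \<in> bdd M"
  by (rule ESkePerLC_homD(6)[OF hom])

lemma adj_bdd: "b \<in> bdd M \<Longrightarrow> adj b \<in> bdd L"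
  by (rule ESkePerLC_homD(7)[OF hom])

text \<open>
The meet of \<open>b\<close> and \<open>\<psi> a\<close> is nonzero and lies below \<open>\<psi> a\<close>, so it is \<open>\<psi> c\<close> for some nonzero \<open>c\<close> below \<open>a\<close>;
since \<open>\<psi> c\<close> lies below \<open>b\<close>, the element \<open>c\<close> lies below \<open>adj b\<close> as well.
\<close>

lemma meets_adj:
  assumes a: "a \<in> carrier L" and b: "b \<in> carrier M" and meets: "Y interior_of (s b) \<inter> s (\<psi> a) \<noteq> {}"
  shows "r a \<inter> r (adj b) \<noteq> {}"
proof -
  note pa = psi_closed[OF a]
  let ?m = "b \<sqinter>\<^bsub>M\<^esub> \<psi> a"
  have m: "?m \<in> carrier M" using b pa by simp
  have "Y interior_of (s b) \<inter> Y interior_of (s (\<psi> a)) \<noteq> {}"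
    by (rule Y.interior_meets[OF Y.regular[OF pa] _ meets]) simp
  moreover have "Y interior_of (s b) \<inter> Y interior_of (s (\<psi> a)) \<subseteq> s ?m"
    using b pa by (simp add: Y.r_meet regular_meet_def)
      (meson closure_of_subset inf.coboundedI1 interior_of_subset_topspace)
  ultimately have ne: "s ?m \<noteq> {}" by blast
  obtain c where c: "c \<in> carrier L" "c \<sqsubseteq>\<^bsub>L\<^esub> a" "\<psi> c = ?m"
    using ESkePerLC_homD(4)[OF hom a m Y.meet_right[OF b pa]] by blast
  have "r c \<noteq> {}" using psi_empty_iff[OF c(1)] c(3) ne by simp
  moreover have "r c \<subseteq> r a" using c a by (simp add: X.le_iff)
  moreover have "r c \<subseteq> r (adj b)"
    using adj_iff[OF c(1) b] c(3) Y.meet_left[OF b pa] b m by (simp add: Y.le_iff)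
  ultimately show ?thesis by blast
qed

text \<open>
The candidates for the value at \<open>x\<close> of a map that induces \<open>\<psi>\<close>.
\<close>

definition limit_points :: "'x \<Rightarrow> 'y set" where
  "limit_points x = (\<Inter>a \<in> X.nbhds x. s (\<psi> a))"

text \<open>
Otherwise \<open>x\<close> would have a neighbourhood \<open>r a\<close> disjoint from the closed set \<open>r (adj b)\<close>, although \<open>s (\<psi> a)\<close> contains \<open>y\<close> and so
meets the interior of \<open>s b\<close>.
\<close>

lemma limit_points_adj:
  assumes x: "x \<in> topspace X" and y: "y \<in> limit_points x" and b: "b \<in> Y.nbhds y"
  shows "x \<in> r (adj b)"
proof (rule ccontr)
  note b = Y.nbhdsD[OF b]
  assume "x \<notin> r (adj b)"
  then obtain a where a: "a \<in> X.nbhds x" "r a \<subseteq> topspace X - r (adj b)"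
    using X.nbhds_within[of "topspace X - r (adj b)" x] x X.r_closedin[OF adj_closed[OF b(2)]] by blast
  have "y \<in> Y interior_of (s b) \<inter> s (\<psi> a)" using y a(1) b(3) unfolding limit_points_def by blast
  then show False using meets_adj[OF X.nbhdsD(2)[OF a(1)] b(2)] a(2) by blast
qed

lemma limit_points_subset:
  assumes x: "x \<in> topspace X" shows "limit_points x \<subseteq> topspace Y"
proof -
  obtain a where "a \<in> X.nbhds x" using X.nbhds_nonempty[OF x] by blast
  then show ?thesis
    using regular_closedD(3)[OF Y.regular[OF psi_closed[OF X.nbhdsD(2)]]] unfolding limit_points_def by blast
qed

lemma directed_psi:
  assumes x: "x \<in> topspace X"
  shows "(\<lambda>a. s (\<psi> a)) ` X.nbhds x \<noteq> {}"
    and "\<And>K. K \<in> (\<lambda>a. s (\<psi> a)) ` X.nbhds x \<Longrightarrow> compactin Y K"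
    and "\<And>K K'. \<lbrakk>K \<in> (\<lambda>a. s (\<psi> a)) ` X.nbhds x; K' \<in> (\<lambda>a. s (\<psi> a)) ` X.nbhds x\<rbrakk>
        \<Longrightarrow> \<exists>K'' \<in> (\<lambda>a. s (\<psi> a)) ` X.nbhds x. K'' \<subseteq> K \<inter> K'"
proof -
  show "(\<lambda>a. s (\<psi> a)) ` X.nbhds x \<noteq> {}" using X.nbhds_nonempty[OF x] by simp
  show "compactin Y K" if "K \<in> (\<lambda>a. s (\<psi> a)) ` X.nbhds x" for K
    using that X.nbhdsD(1) psi_bdd Y.compact_r by blast
  fix K K' assume "K \<in> (\<lambda>a. s (\<psi> a)) ` X.nbhds x" "K' \<in> (\<lambda>a. s (\<psi> a)) ` X.nbhds x"
  then obtain a b where a: "a \<in> X.nbhds x" "K = s (\<psi> a)" and b: "b \<in> X.nbhds x" "K' = s (\<psi> b)" by blast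
  note ac = X.nbhdsD(2)[OF a(1)] and bc = X.nbhdsD(2)[OF b(1)]
  have "r (a \<sqinter>\<^bsub>L\<^esub> b) \<subseteq> r a" "r (a \<sqinter>\<^bsub>L\<^esub> b) \<subseteq> r b"
    using ac bc X.meet_left[OF ac bc] X.meet_right[OF ac bc] by (simp_all add: X.le_iff)
  then have "s (\<psi> (a \<sqinter>\<^bsub>L\<^esub> b)) \<subseteq> K \<inter> K'"
    using psi_mono[of "a \<sqinter>\<^bsub>L\<^esub> b" a] psi_mono[of "a \<sqinter>\<^bsub>L\<^esub> b" b] ac bc a b by simp
  then show "\<exists>K'' \<in> (\<lambda>a. s (\<psi> a)) ` X.nbhds x. K'' \<subseteq> K \<inter> K'"
    using X.nbhds_meet[OF a(1) b(1)] by blast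
qed

lemma limit_points_nonempty:
  assumes x: "x \<in> topspace X" shows "limit_points x \<noteq> {}"
proof -
  have "{} \<notin> (\<lambda>a. s (\<psi> a)) ` X.nbhds x"
    using psi_empty_iff X.nbhdsD(2,4) by blast
  then show ?thesis
    unfolding limit_points_def using directed_compact_Inter_nonempty[OF Y.Hausdorff directed_psi(1,2)[OF x] _ directed_psi(3)[OF x]]
    by blast
qed

text \<open>
Disjoint neighbourhoods \<open>s b\<close> and \<open>s c\<close> of two candidates would give \<open>x\<close> in both \<open>r (adj b)\<close> and \<open>r (adj c)\<close>, and contact
of these two elements is preserved by \<open>\<psi>\<close>.
\<close>

lemma limit_points_unique:
  assumes x: "x \<in> topspace X" and y: "y \<in> limit_points x" and z: "z \<in> limit_points x"
  shows "y = z"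
proof (rule ccontr)
  assume "y \<noteq> z"
  then obtain b c where bc: "b \<in> Y.nbhds y" "c \<in> Y.nbhds z" "s b \<inter> s c = {}"
    using Y.nbhds_separate[of y z] limit_points_subset[OF x] y z by blast
  note b = Y.nbhdsD(2)[OF bc(1)] and c = Y.nbhdsD(2)[OF bc(2)]
  have "x \<in> r (adj b) \<inter> r (adj c)"
    using limit_points_adj[OF x y bc(1)] limit_points_adj[OF x z bc(2)] by blast
  then have "s (\<psi> (adj b)) \<inter> s (\<psi> (adj c)) \<noteq> {}"
    using psi_meets[OF adj_closed[OF b] adj_closed[OF c]] by blast
  then show False using psi_adj[OF b] psi_adj[OF c] bc(3) by blast
qed

definition dual_map :: "'x \<Rightarrow> 'y" where
  "dual_map = (\<lambda>x \<in> topspace X. SOME y. y \<in> limit_points x)"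

lemma limit_points_eq:
  assumes x: "x \<in> topspace X" shows "limit_points x = {dual_map x}"
proof -
  have "dual_map x \<in> limit_points x"
    unfolding dual_map_def using x limit_points_nonempty[OF x] by (simp add: some_in_eq)
  then show ?thesis using limit_points_unique[OF x] by blast
qed

lemma dual_map_topspace: "x \<in> topspace X \<Longrightarrow> dual_map x \<in> topspace Y"
  using limit_points_eq limit_points_subset by blast

text \<open>
A neighbourhood \<open>s b\<close> of the value at \<open>x\<close> that misses \<open>s (\<psi> a)\<close> would put \<open>x\<close> into \<open>r a\<close> and \<open>r (adj b)\<close>, forcing \<open>\<psi> a\<close> to
be in contact with an element below \<open>b\<close>.
\<close>

lemma dual_map_in_psi:
  assumes a: "a \<in> carrier L" and x: "x \<in> r a"
  shows "dual_map x \<in> s (\<psi> a)"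
proof (rule ccontr)
  assume nin: "dual_map x \<notin> s (\<psi> a)"
  have xt: "x \<in> topspace X" using x regular_closedD(3)[OF X.regular[OF a]] by blast
  obtain b where b: "b \<in> Y.nbhds (dual_map x)" "s b \<subseteq> topspace Y - s (\<psi> a)"
    using Y.nbhds_within[of "topspace Y - s (\<psi> a)" "dual_map x"] nin dual_map_topspace[OF xt]
      Y.r_closedin[OF psi_closed[OF a]] by blast
  note bc = Y.nbhdsD(2)[OF b(1)]
  have "x \<in> r (adj b)" using limit_points_adj[OF xt _ b(1)] limit_points_eq[OF xt] by blast
  then have "s (\<psi> a) \<inter> s (\<psi> (adj b)) \<noteq> {}"
    using psi_meets[OF a adj_closed[OF bc]] x by blast
  then show False using psi_adj[OF bc] b(2) by blast
qed

text \<open>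
As \<open>b\<close> ranges over the compact neighbourhoods of \<open>y\<close>, the sets \<open>r a \<inter> r (adj b)\<close> are nonempty, compact and directed.  A
point in all of them is mapped into every neighbourhood of \<open>y\<close>, hence to \<open>y\<close>.
\<close>

lemma psi_subset_dual_map:
  assumes a: "a \<in> carrier L" and y: "y \<in> s (\<psi> a)"
  shows "y \<in> dual_map ` r a"
proof -
  let ?K = "(\<lambda>b. r a \<inter> r (adj b)) ` Y.nbhds y"
  have yt: "y \<in> topspace Y" using y regular_closedD(3)[OF Y.regular[OF psi_closed[OF a]]] by blast
  have "\<Inter>?K \<noteq> {}"
  proof (rule directed_compact_Inter_nonempty[OF X.Hausdorff])
    show "?K \<noteq> {}" using Y.nbhds_nonempty[OF yt] by simp
    show "compactin X K" if K: "K \<in> ?K" for K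
    proof -
      obtain b where b: "b \<in> Y.nbhds y" "K = r a \<inter> r (adj b)" using K by blast
      show ?thesis
        unfolding b(2) using X.r_closedin[OF a] X.compact_r[OF adj_bdd[OF Y.nbhdsD(1)[OF b(1)]]]
        by (rule closed_Int_compactin)
    qed
    show "{} \<notin> ?K"
    proof
      assume "{} \<in> ?K"
      then obtain b where b: "b \<in> Y.nbhds y" "r a \<inter> r (adj b) = {}" by auto
      then show False using meets_adj[OF a Y.nbhdsD(2)[OF b(1)]] Y.nbhdsD(3)[OF b(1)] y by blast
    qed
    fix K K' assume "K \<in> ?K" "K' \<in> ?K"
    then obtain b c where b: "b \<in> Y.nbhds y" "K = r a \<inter> r (adj b)" and c: "c \<in> Y.nbhds y" "K' = r a \<inter> r (adj c)" by blast
    note bc = Y.nbhdsD(2)[OF b(1)] and cc = Y.nbhdsD(2)[OF c(1)]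
    have "s (b \<sqinter>\<^bsub>M\<^esub> c) \<subseteq> s b" "s (b \<sqinter>\<^bsub>M\<^esub> c) \<subseteq> s c"
      using bc cc Y.meet_left[OF bc cc] Y.meet_right[OF bc cc] by (simp_all add: Y.le_iff)
    then have "r a \<inter> r (adj (b \<sqinter>\<^bsub>M\<^esub> c)) \<subseteq> K \<inter> K'"
      using adj_mono[of "b \<sqinter>\<^bsub>M\<^esub> c" b] adj_mono[of "b \<sqinter>\<^bsub>M\<^esub> c" c] bc cc b c by auto
    then show "\<exists>K'' \<in> ?K. K'' \<subseteq> K \<inter> K'" using Y.nbhds_meet[OF b(1) c(1)] by blast
  qed
  then obtain x where x: "\<And>b. b \<in> Y.nbhds y \<Longrightarrow> x \<in> r a \<inter> r (adj b)" by blast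
  have xa: "x \<in> r a" using x Y.nbhds_nonempty[OF yt] by blast
  then have xt: "x \<in> topspace X" using regular_closedD(3)[OF X.regular[OF a]] by blast
  have "dual_map x = y"
  proof (rule ccontr)
    assume "dual_map x \<noteq> y"
    then obtain b c where bc: "b \<in> Y.nbhds (dual_map x)" "c \<in> Y.nbhds y" "s b \<inter> s c = {}"
      using Y.nbhds_separate[OF dual_map_topspace[OF xt] yt] by blast
    note cc = Y.nbhdsD(2)[OF bc(2)]
    have "dual_map x \<in> s (\<psi> (adj c))"
      using x[OF bc(2)] by (intro dual_map_in_psi adj_closed[OF cc]) auto
    then show False using psi_adj[OF cc] Y.nbhdsD(4)[OF bc(1)] bc(3) by blast
  qed
  then show ?thesis using xa by blast
qed

lemma dual_map_image: "a \<in> carrier L \<Longrightarrow> dual_map ` r a = s (\<psi> a)"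
  using dual_map_in_psi psi_subset_dual_map by blast

text \<open>
The sets \<open>s (\<psi> a)\<close>, for \<open>a\<close> a neighbourhood of \<open>x\<close>, shrink to the value at \<open>x\<close>; by compactness one of them already lies in a
given neighbourhood of that value.
\<close>

lemma continuous_dual_map: "continuous_map X Y dual_map"
  unfolding continuous_map
proof (intro conjI allI impI)
  show "dual_map ` topspace X \<subseteq> topspace Y" using dual_map_topspace by blast
  fix V assume V: "openin Y V"
  show "openin X {x \<in> topspace X. dual_map x \<in> V}"
  proof (subst openin_subopen, intro ballI)
    fix x assume "x \<in> {x \<in> topspace X. dual_map x \<in> V}"
    then have x: "x \<in> topspace X" "dual_map x \<in> V" by auto
    have "\<exists>K \<in> (\<lambda>a. s (\<psi> a)) ` X.nbhds x. K \<subseteq> V"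
      by (rule directed_compact_Inter_subset[OF Y.Hausdorff directed_psi(1,2)[OF x(1)] directed_psi(3)[OF x(1)] V])
        (use limit_points_eq[OF x(1)] x(2) in \<open>auto simp: limit_points_def\<close>)
    then obtain a where a: "a \<in> X.nbhds x" "s (\<psi> a) \<subseteq> V" by blast
    have "X interior_of (r a) \<subseteq> {x \<in> topspace X. dual_map x \<in> V}"
      using a(2) dual_map_in_psi[OF X.nbhdsD(2)[OF a(1)]] interior_of_subset[of X "r a"]
        interior_of_subset_topspace[of X "r a"] by blast
    then show "\<exists>T. openin X T \<and> x \<in> T \<and> T \<subseteq> {x \<in> topspace X. dual_map x \<in> V}"
      using X.nbhdsD(3)[OF a(1)] by (intro exI[of _ "X interior_of (r a)"]) auto
  qed
qed

text \<open>
Over a locally compact Hausdorff space it suffices that preimages of compact sets are compact, and the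
preimage of the interior of a compact \<open>s b\<close> is contained in \<open>r (adj b)\<close>.
\<close>

lemma proper_dual_map: "proper_map X Y dual_map"
proof (rule compact_imp_proper_map)
  show "k_space Y" by (rule locally_compact_imp_k_space[OF Y.locally_compact])
  show "kc_space Y" by (rule Hausdorff_imp_kc_space[OF Y.Hausdorff])
  show "dual_map \<in> topspace X \<rightarrow> topspace Y" using dual_map_topspace by blast
  show "continuous_map X Y dual_map \<or> kc_space X" using continuous_dual_map by blast
  fix K assume K: "compactin Y K"
  obtain F where F: "F \<in> regular_closed Y" "compactin Y F" "K \<subseteq> Y interior_of F" "F \<subseteq> topspace Y"
    by (rule regular_closed_nbhd[OF Y.locally_compact Y.Hausdorff K openin_topspace])
      (use K in \<open>auto simp: compactin_subset_topspace\<close>)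
  define b where "b = Y.code F"
  have b: "b \<in> carrier M" "s b = F" "b \<in> bdd M"
    unfolding b_def using F by (simp_all add: Y.code_closed Y.r_code Y.bdd_eq)
  have "{x \<in> topspace X. dual_map x \<in> K} \<subseteq> r (adj b)"
  proof
    fix x assume "x \<in> {x \<in> topspace X. dual_map x \<in> K}"
    then have x: "x \<in> topspace X" "dual_map x \<in> K" by auto
    have "b \<in> Y.nbhds (dual_map x)" unfolding Y.nbhds_def using b F(3) x(2) by auto
    then show "x \<in> r (adj b)" using limit_points_adj[OF x(1)] limit_points_eq[OF x(1)] by blast
  qed
  moreover have "closedin X {x \<in> topspace X. dual_map x \<in> K}"
    using continuous_dual_map compactin_imp_closedin[OF Y.Hausdorff K] by (rule closedin_continuous_map_preimage)
  ultimately show "compactin X {x \<in> topspace X. dual_map x \<in> K}"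
    using X.compact_r[OF adj_bdd[OF b(3)]] closed_compactin by blast
qed

lemma skeletal_perfect_dual_map: "skeletal_perfect X Y dual_map"
proof -
  have "skeletal_perfect X Y (restrict dual_map (topspace X))"
  proof (rule skeletal_perfect_restrictI[OF X.locally_compact X.Hausdorff continuous_dual_map proper_dual_map])
    fix F assume "F \<in> regular_closed X"
    then show "dual_map ` F \<in> regular_closed Y"
      using dual_map_image[of "X.code F"] Y.regular[OF psi_closed[of "X.code F"]]
      by (simp add: X.code_closed X.r_code)
  qed
  then show ?thesis by (simp add: dual_map_def)
qed

lemma induced_dual_map: "induced dual_map = \<psi>"
  using ESkePerLC_homD(1)[OF hom] by (intro induced_eqI) (auto simp: dual_map_image psi_closed PiE_def)

end

theorem (in rc_pair) induced_bij:
  "bij_betw induced {f. skeletal_perfect X Y f} (ESkePerLC_hom L M)"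
  unfolding bij_betw_def
proof (intro conjI equalityI subsetI)
  show "inj_on induced {f. skeletal_perfect X Y f}"
    using induced_inj by (auto intro: inj_onI)
  show "\<psi> \<in> ESkePerLC_hom L M" if "\<psi> \<in> induced ` {f. skeletal_perfect X Y f}" for \<psi>
    using that induced_hom by auto
  fix \<psi> assume "\<psi> \<in> ESkePerLC_hom L M"
  then interpret rc_morphism X L r Y M s \<psi> by unfold_locales
  show "\<psi> \<in> induced ` {f. skeletal_perfect X Y f}"
    using skeletal_perfect_dual_map induced_dual_map by (metis image_eqI mem_Collect_eq)
qed

section \<open>Functoriality\<close>

lemma (in rc_pair) induced_compose:
  assumes "rc_representation Z N t" and f: "skeletal_perfect X Y f" and g: "skeletal_perfect Y Z g"
  shows "compose (carrier L) (rc_pair.induced M s N t g) (induced f) =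
    rc_pair.induced L r N t (compose (topspace X) g f)"
proof -
  interpret Z: rc_representation Z N t by fact
  interpret YZ: rc_pair Y M s Z N t by unfold_locales
  interpret XZ: rc_pair X L r Z N t by unfold_locales
  have "t (YZ.induced g (induced f a)) = compose (topspace X) g f ` r a" if a: "a \<in> carrier L" for a
  proof -
    have "t (YZ.induced g (induced f a)) = g ` f ` r a"
      using YZ.s_induced(2)[OF g s_induced(1)[OF f a]] s_induced(2)[OF f a] by simp
    also have "\<dots> = compose (topspace X) g f ` r a"
      using regular_closedD(3)[OF X.regular[OF a]] by (force simp: compose_def)
    finally show ?thesis .
  qed
  then show ?thesis
    using YZ.s_induced(1)[OF g s_induced(1)[OF f]]
    by (intro XZ.induced_eqI[symmetric]) (auto simp: compose_def)
qed

lemma (in rc_representation) induced_ident: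
  "rc_pair.induced L r L r (\<lambda>x \<in> topspace X. x) = (\<lambda>a \<in> carrier L. a)"
proof -
  interpret rc_pair X L r X L r by unfold_locales
  have "(\<lambda>x \<in> topspace X. x) ` r a = r a" if "a \<in> carrier L" for a
    using regular_closedD(3)[OF regular[OF that]] by (auto simp: subset_eq image_iff)
  then show ?thesis by (intro induced_eqI) auto
qed

section \<open>Realising spaces and algebras inside the universe\<close>

text \<open>
An injection \<open>e\<close> of the subsets of the space turns its regular closed sets into elements of any given type, in
particular into elements of the universe.
\<close>

definition decode :: "('x set \<Rightarrow> 'a) \<Rightarrow> 'x topology \<Rightarrow> 'a \<Rightarrow> 'x set" where
  "decode e X = inv_into (Pow (topspace X)) e"

definition rc_algebra :: "('x set \<Rightarrow> 'a) \<Rightarrow> 'x topology \<Rightarrow> 'a local_contact_structure" where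
  "rc_algebra e X = \<lparr>carrier = e ` regular_closed X, eq = (=),
     le = \<lambda>a b. decode e X a \<subseteq> decode e X b,
     contact = {(a, b). a \<in> e ` regular_closed X \<and> b \<in> e ` regular_closed X \<and>
       decode e X a \<inter> decode e X b \<noteq> {}},
     bdd = {a \<in> e ` regular_closed X. compactin X (decode e X a)}\<rparr>"

lemma rc_representation_rc_algebra:
  assumes X: "locally_compact_space X" "Hausdorff_space X" and e: "inj_on e (Pow (topspace X))"
  shows "rc_representation X (rc_algebra e X) (decode e X)"
proof -
  have sub: "regular_closed X \<subseteq> Pow (topspace X)" using regular_closedD(3) by blast
  have "bij_betw (decode e X) (e ` regular_closed X) (regular_closed X)"
    unfolding decode_def using sub e by (intro bij_betw_byWitness[where f' = e]) auto
  then show ?thesis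
    by unfold_locales (use X in \<open>auto simp: rc_algebra_def\<close>)
qed

lemma rc_representation_dual_space:
  fixes L :: "'a local_contact_structure"
  assumes "complete_local_contact_algebra L"
  shows "rc_representation (local_contact_algebra.dual_space L) L (local_contact_algebra.region L)"
proof -
  interpret complete_local_contact_algebra L by fact
  have "inj_on region (carrier L)"
  proof (rule inj_onI)
    fix a b assume ab: "a \<in> carrier L" "b \<in> carrier L" "region a = region b"
    then have "a \<sqsubseteq>\<^bsub>L\<^esub> b" "b \<sqsubseteq>\<^bsub>L\<^esub> a" using region_subset_iff[of a b] region_subset_iff[of b a] by simp_all
    then show "a = b" using ab by (intro le_antisym)
  qed
  then have "bij_betw region (carrier L) (regular_closed dual_space)"
    by (simp add: bij_betw_def region_image)
  moreover have "contact L = {(a, b). a \<in> carrier L \<and> b \<in> carrier L \<and> region a \<inter> region b \<noteq> {}}"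
  proof (rule Set.set_eqI)
    fix u :: "'a \<times> 'a"
    obtain a b where "u = (a, b)" by (cases u)
    then show "u \<in> contact L \<longleftrightarrow>
        u \<in> {(a, b). a \<in> carrier L \<and> b \<in> carrier L \<and> region a \<inter> region b \<noteq> {}}"
      using contact_closed[of a b] contact_iff_regions_meet[of a b] by auto
  qed
  moreover have "bdd L = {a \<in> carrier L. compactin dual_space (region a)}"
    using bdd_closed compactin_region_iff by auto
  ultimately show ?thesis
    unfolding rc_representation_def
    using locally_compact_dual_space Hausdorff_dual_space eq_is_equal region_subset_iff by simp
qed

lemma rc_representation_homeomorphic:
  assumes "rc_representation X L r" and h: "homeomorphic_map X Y h"
  shows "rc_representation Y L (\<lambda>a. h ` r a)"
proof -
  interpret rc_representation X L r by fact
  have inj: "inj_on h (topspace X)" and im: "h ` topspace X = topspace Y"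
    using h by (auto simp: homeomorphic_eq_everything_map)
  have sub: "F \<subseteq> topspace X" if "F \<in> regular_closed X" for F
    using regular_closedD(3) that by blast
  have reg: "h ` F \<in> regular_closed Y \<longleftrightarrow> F \<in> regular_closed X" if F: "F \<subseteq> topspace X" for F
    using homeomorphic_map_closure_of[OF h, of "X interior_of F"] homeomorphic_map_interior_of[OF h F]
      inj_on_image_eq_iff[OF inj closure_of_subset_topspace F] interior_of_subset_topspace[of X F]
    unfolding regular_closed_def by simp
  have "(`) h ` regular_closed X = regular_closed Y"
  proof (intro equalityI subsetI)
    fix G assume G: "G \<in> regular_closed Y"
    then obtain F where "F \<subseteq> topspace X" "G = h ` F"
      using regular_closedD(3)[OF G] im by (metis subset_imageE)
    then show "G \<in> (`) h ` regular_closed X" using reg G by blast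
  qed (use reg sub in blast)
  moreover have "inj_on ((`) h) (regular_closed X)"
    by (rule inj_on_subset[OF inj_on_image_Pow[OF inj]]) (use sub in blast)
  ultimately have "bij_betw ((`) h \<circ> r) (carrier L) (regular_closed Y)"
    by (intro bij_betw_trans[OF bij]) (auto simp: bij_betw_def)
  moreover have "locally_compact_space Y" "Hausdorff_space Y"
    using h locally_compact Hausdorff homeomorphic_locally_compact_space homeomorphic_Hausdorff_space
      homeomorphic_map_imp_homeomorphic_space by blast+
  moreover have "compactin Y (h ` r a) \<longleftrightarrow> compactin X (r a)" if "a \<in> carrier L" for a
    using homeomorphic_map_compactness[OF h] sub regular[OF that] by blast
  moreover have "h ` r a \<subseteq> h ` r b \<longleftrightarrow> r a \<subseteq> r b" if "a \<in> carrier L" "b \<in> carrier L" for a b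
    by (rule inj_on_image_subset_iff[OF inj]) (use sub regular that in auto)
  moreover have "h ` r a \<inter> h ` r b = {} \<longleftrightarrow> r a \<inter> r b = {}" if "a \<in> carrier L" "b \<in> carrier L" for a b
    using inj_on_image_Int[OF inj sub[OF regular[OF that(1)]] sub[OF regular[OF that(2)]]] by (metis image_is_empty)
  ultimately show ?thesis
    unfolding rc_representation_def using eq_equality le_iff contact_eq bdd_eq
    by (simp add: o_def cong: conj_cong)
qed

text \<open>
The dual space consists of sets of elements of the algebra; copying it along an injection brings it back into the universe.
\<close>

lemma homeomorphic_copy_exists:
  assumes h: "inj_on h (topspace X)"
  obtains Y where "topspace Y = h ` topspace X" "homeomorphic_map X Y h"
proof -
  let ?g = "inv_into (topspace X) h"
  define Y where "Y = pullback_topology (h ` topspace X) ?g X"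
  have top: "topspace Y = h ` topspace X"
    unfolding Y_def topspace_pullback_topology using h by auto
  have "homeomorphic_maps X Y h ?g"
    unfolding homeomorphic_maps_def
  proof (intro conjI ballI)
    show "continuous_map X Y h"
      unfolding Y_def by (intro continuous_map_pullback') (use h in \<open>auto intro: continuous_map_eq[of X X id]\<close>)
    show "continuous_map Y X ?g"
      unfolding Y_def using continuous_map_pullback[of X X id "h ` topspace X" ?g] by simp
  qed (use h top in auto)
  then show ?thesis using that[OF top] by (simp add: homeomorphic_maps_map)
qed

section \<open>The equivalence\<close>

lemma SkePerLC_simps:
  "X \<in> Obj (SkePerLC \<U>) \<longleftrightarrow> topspace X \<in> \<U> \<and> locally_compact_space X \<and> Hausdorff_space X"
  "Hom (SkePerLC \<U>) X Y = {f. skeletal_perfect X Y f}"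
  "Ident (SkePerLC \<U>) X = (\<lambda>x \<in> topspace X. x)"
  "Comp (SkePerLC \<U>) X Y Z g f = compose (topspace X) g f"
  by (auto simp: SkePerLC_def skeletal_perfect_def)

lemma ESkePerLC_simps:
  "A \<in> Obj (ESkePerLC \<U>) \<longleftrightarrow> carrier A \<in> \<U> \<and> complete_local_contact_algebra A"
  "Hom (ESkePerLC \<U>) A B = ESkePerLC_hom A B"
  "Ident (ESkePerLC \<U>) A = (\<lambda>a \<in> carrier A. a)"
  "Comp (ESkePerLC \<U>) A B D \<psi> \<phi> = compose (carrier A) \<psi> \<phi>"
  by (auto simp: ESkePerLC_def)

lemma category_SkePerLC: "category (SkePerLC \<U>)"
proof
  fix X Y f assume "f \<in> Hom (SkePerLC \<U>) X Y"
  then have "f \<in> topspace X \<rightarrow> topspace Y" "f \<in> extensional (topspace X)"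
    using skeletal_perfectD(1)[of X Y f] by (auto simp: SkePerLC_simps PiE_def)
  then show "Comp (SkePerLC \<U>) X X Y f (Ident (SkePerLC \<U>) X) = f"
    and "Comp (SkePerLC \<U>) X Y Y (Ident (SkePerLC \<U>) Y) f = f"
    by (simp_all add: SkePerLC_simps Id_compose compose_Id)
next
  fix W X Y Z f g h assume "f \<in> Hom (SkePerLC \<U>) W X"
  then have "f \<in> topspace W \<rightarrow> topspace X"
    using skeletal_perfectD(1)[of W X f] by (auto simp: SkePerLC_simps)
  then show "Comp (SkePerLC \<U>) W Y Z h (Comp (SkePerLC \<U>) W X Y g f) =
      Comp (SkePerLC \<U>) W X Z (Comp (SkePerLC \<U>) X Y Z h g) f"
    by (simp add: SkePerLC_simps compose_assoc)
qed (simp_all add: SkePerLC_simps skeletal_perfect_ident skeletal_perfect_compose)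

lemma category_ESkePerLC: "category (ESkePerLC \<U>)"
proof
  fix A B f assume "f \<in> Hom (ESkePerLC \<U>) A B"
  then have "f \<in> carrier A \<rightarrow> carrier B" "f \<in> extensional (carrier A)"
    using ESkePerLC_homD(1)[of f A B] by (auto simp: ESkePerLC_simps PiE_def)
  then show "Comp (ESkePerLC \<U>) A A B f (Ident (ESkePerLC \<U>) A) = f"
    and "Comp (ESkePerLC \<U>) A B B (Ident (ESkePerLC \<U>) B) f = f"
    by (simp_all add: ESkePerLC_simps Id_compose compose_Id)
next
  fix A B E D f g h assume "f \<in> Hom (ESkePerLC \<U>) A B"
  then have "f \<in> carrier A \<rightarrow> carrier B"
    using ESkePerLC_homD(1)[of f A B] by (auto simp: ESkePerLC_simps)
  then show "Comp (ESkePerLC \<U>) A E D h (Comp (ESkePerLC \<U>) A B E g f) =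
      Comp (ESkePerLC \<U>) A B D (Comp (ESkePerLC \<U>) B E D h g) f"
    by (simp add: ESkePerLC_simps compose_assoc)
next
  fix A B D \<phi> \<psi>
  assume A: "A \<in> Obj (ESkePerLC \<U>)" and D: "D \<in> Obj (ESkePerLC \<U>)"
    and "\<phi> \<in> Hom (ESkePerLC \<U>) A B" "\<psi> \<in> Hom (ESkePerLC \<U>) B D"
  interpret A: complete_local_contact_algebra A using A by (simp add: ESkePerLC_simps)
  interpret D: complete_local_contact_algebra D using D by (simp add: ESkePerLC_simps)
  have "bdd A \<subseteq> carrier A" "bdd D \<subseteq> carrier D"
    using A.bdd_closed D.bdd_closed by (auto simp only:)
  then show "Comp (ESkePerLC \<U>) A B D \<psi> \<phi> \<in> Hom (ESkePerLC \<U>) A D"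
    using \<open>\<phi> \<in> _\<close> \<open>\<psi> \<in> _\<close> by (simp add: ESkePerLC_simps ESkePerLC_hom_compose)
qed (simp add: ESkePerLC_simps ESkePerLC_hom_ident)

lemma universe_subset: "\<lbrakk>universe \<U>; A \<in> \<U>; B \<subseteq> A\<rbrakk> \<Longrightarrow> B \<in> \<U>"
  unfolding universe_def by blast

lemma universe_Pow:
  assumes "universe \<U>" "A \<in> \<U>"
  obtains e where "inj_on e (Pow A)" "e ` Pow A \<in> \<U>"
  using assms unfolding universe_def by blast

text \<open>
The points of the dual space are subsets of the carrier, so coding the power set of the carrier suffices.
\<close>

lemma representing_space_exists:
  assumes U: "universe \<U>" and A: "A \<in> Obj (ESkePerLC \<U>)"
  obtains X r where "X \<in> Obj (SkePerLC \<U>)" "rc_representation X A r"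
proof -
  have A: "carrier A \<in> \<U>" "complete_local_contact_algebra A" using A by (auto simp: ESkePerLC_simps)
  interpret complete_local_contact_algebra A by fact
  obtain e where e: "inj_on e (Pow (carrier A))" "e ` Pow (carrier A) \<in> \<U>"
    by (rule universe_Pow[OF U A(1)])
  have sub: "topspace dual_space \<subseteq> Pow (carrier A)" using pointD(1) by auto
  obtain X where X: "topspace X = e ` topspace dual_space" "homeomorphic_map dual_space X e"
    by (rule homeomorphic_copy_exists[OF inj_on_subset[OF e(1) sub]])
  have rep: "rc_representation X A (\<lambda>a. e ` region a)"
    by (rule rc_representation_homeomorphic[OF rc_representation_dual_space[OF A(2)] X(2)])
  interpret X: rc_representation X A "\<lambda>a. e ` region a" by (rule rep)
  have "topspace X \<in> \<U>" unfolding X(1) by (rule universe_subset[OF U e(2)]) (rule image_mono[OF sub])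
  then have "X \<in> Obj (SkePerLC \<U>)"
    using X.locally_compact X.Hausdorff by (simp add: SkePerLC_simps)
  then show ?thesis using rep by (rule that)
qed

theorem theorem4p6:
  fixes \<U> :: "'u set set"
  assumes "universe \<U>"
  shows "equivalent_categories (SkePerLC \<U>) (ESkePerLC \<U>)"
proof -
  note U = assms
  have "\<forall>X. \<exists>e :: 'u set \<Rightarrow> 'u. X \<in> Obj (SkePerLC \<U>) \<longrightarrow> inj_on e (Pow (topspace X)) \<and> e ` Pow (topspace X) \<in> \<U>"
    using universe_Pow[OF U] by (simp add: SkePerLC_simps) metis
  then obtain e :: "'u topology \<Rightarrow> 'u set \<Rightarrow> 'u" where e: "\<And>X. X \<in> Obj (SkePerLC \<U>) \<Longrightarrow>
      inj_on (e X) (Pow (topspace X)) \<and> e X ` Pow (topspace X) \<in> \<U>"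
    by metis
  define R where "R X = rc_algebra (e X) X" for X
  define d where "d X = decode (e X) X" for X
  have rep: "rc_representation X (R X) (d X)" if "X \<in> Obj (SkePerLC \<U>)" for X
    unfolding R_def d_def using that e[OF that]
    by (intro rc_representation_rc_algebra) (auto simp: SkePerLC_simps)
  have R: "R X \<in> Obj (ESkePerLC \<U>)" if X: "X \<in> Obj (SkePerLC \<U>)" for X
  proof -
    interpret rc_representation X "R X" "d X" by (rule rep[OF X])
    have "carrier (R X) \<subseteq> e X ` Pow (topspace X)"
      using regular_closedD(3) by (fastforce simp: R_def rc_algebra_def)
    then have "carrier (R X) \<in> \<U>" using universe_subset[OF U] e[OF X] by blast
    then show ?thesis using complete_local_contact_algebra by (simp add: ESkePerLC_simps)
  qed
  define F where "F = \<lparr>fobj = R, fmap = \<lambda>X Y f. rc_pair.induced (R X) (d X) (R Y) (d Y) f\<rparr>"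
  have pair: "rc_pair X L r Y M s" if "rc_representation X L r" "rc_representation Y M s"
    for X :: "'u topology" and L :: "'u local_contact_structure" and r and Y :: "'u topology" and M :: "'u local_contact_structure" and s
    using that by (simp add: rc_pair_def)
  have "is_functor (SkePerLC \<U>) (ESkePerLC \<U>) F"
    unfolding is_functor_def
  proof (intro conjI ballI)
    fix X assume X: "X \<in> Obj (SkePerLC \<U>)"
    then show "fobj F X \<in> Obj (ESkePerLC \<U>)" by (simp add: F_def R)
    show "fmap F X X (Ident (SkePerLC \<U>) X) = Ident (ESkePerLC \<U>) (fobj F X)"
      using rc_representation.induced_ident[OF rep[OF X]] by (simp add: F_def SkePerLC_simps ESkePerLC_simps)
    fix Y assume Y: "Y \<in> Obj (SkePerLC \<U>)"
    fix f assume f: "f \<in> Hom (SkePerLC \<U>) X Y"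
    show "fmap F X Y f \<in> Hom (ESkePerLC \<U>) (fobj F X) (fobj F Y)"
      using rc_pair.induced_hom[OF pair[OF rep[OF X] rep[OF Y]]] f
      by (simp add: F_def ESkePerLC_simps SkePerLC_simps)
  next
    fix X Y Z f g
    assume X: "X \<in> Obj (SkePerLC \<U>)" and Y: "Y \<in> Obj (SkePerLC \<U>)" and Z: "Z \<in> Obj (SkePerLC \<U>)"
      and f: "f \<in> Hom (SkePerLC \<U>) X Y" and g: "g \<in> Hom (SkePerLC \<U>) Y Z"
    have "compose (carrier (R X)) (rc_pair.induced (R Y) (d Y) (R Z) (d Z) g) (rc_pair.induced (R X) (d X) (R Y) (d Y) f) =
        rc_pair.induced (R X) (d X) (R Z) (d Z) (compose (topspace X) g f)"
      by (rule rc_pair.induced_compose[OF pair[OF rep[OF X] rep[OF Y]] rep[OF Z]])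
        (use f g in \<open>simp_all add: SkePerLC_simps\<close>)
    then show "fmap F X Z (Comp (SkePerLC \<U>) X Y Z g f) =
        Comp (ESkePerLC \<U>) (fobj F X) (fobj F Y) (fobj F Z) (fmap F Y Z g) (fmap F X Y f)"
      by (simp add: F_def SkePerLC_simps ESkePerLC_simps)
  qed
  moreover have "bij_betw (fmap F X Y) (Hom (SkePerLC \<U>) X Y) (Hom (ESkePerLC \<U>) (fobj F X) (fobj F Y))"
    if "X \<in> Obj (SkePerLC \<U>)" "Y \<in> Obj (SkePerLC \<U>)" for X Y
    using rc_pair.induced_bij[OF pair[OF rep[OF that(1)] rep[OF that(2)]]]
    by (simp add: F_def ESkePerLC_simps SkePerLC_simps)
  moreover have "\<exists>X \<in> Obj (SkePerLC \<U>). \<exists>i. iso_arrow (ESkePerLC \<U>) (fobj F X) A i"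
    if A: "A \<in> Obj (ESkePerLC \<U>)" for A
  proof -
    obtain X r where X: "X \<in> Obj (SkePerLC \<U>)" and r: "rc_representation X A r"
      by (rule representing_space_exists[OF U A])
    interpret P: rc_pair X "R X" "d X" X A r by (rule pair[OF rep[OF X] r])
    interpret Q: rc_pair X A r X "R X" "d X" by (rule pair[OF r rep[OF X]])
    \<comment> \<open>Both algebras represent \<open>X\<close>, and the identity of \<open>X\<close> induces mutually inverse arrows.\<close>
    define \<iota> where "\<iota> = (\<lambda>x \<in> topspace X. x)"
    have i: "skeletal_perfect X X \<iota>"
      unfolding \<iota>_def by (rule skeletal_perfect_ident[OF P.X.locally_compact P.X.Hausdorff])
    have ii: "compose (topspace X) \<iota> \<iota> = \<iota>" unfolding \<iota>_def by (simp add: Id_compose)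
    have "compose (carrier (R X)) (Q.induced \<iota>) (P.induced \<iota>) = (\<lambda>a \<in> carrier (R X). a)"
      using P.induced_compose[OF rep[OF X] i i] P.X.induced_ident ii unfolding \<iota>_def by simp
    moreover have "compose (carrier A) (P.induced \<iota>) (Q.induced \<iota>) = (\<lambda>a \<in> carrier A. a)"
      using Q.induced_compose[OF r i i] rc_representation.induced_ident[OF r] ii unfolding \<iota>_def by simp
    ultimately have "iso_arrow (ESkePerLC \<U>) (R X) A (P.induced \<iota>)"
      unfolding iso_arrow_def using P.induced_hom[OF i] Q.induced_hom[OF i]
      by (auto simp: ESkePerLC_simps)
    then show ?thesis using X by (auto simp: F_def)
  qed
  ultimately show ?thesis
    by (intro equivalent_categoriesI category_SkePerLC category_ESkePerLC)
qed

end
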